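(* Let $f\in C(\mathbb{R}^4)$, $f=f(r,\tau,u,t)$, be bounded and $\kappa$-Lipschitz continuous, $1$-periodic in $r$ and in $\tau$, and non-increasing in $u$. For $(u_0,t_0)\in\mathbb{R}^2$ let $\bar f(u_0,t_0)\in\mathbb{R}$ be the constant such that, for every $c\in\mathbb{R}$ and $t>0$, $\lim_{\varepsilon\to0}u^\varepsilon(t;c,u_0,t_0)=c+\bar f(u_0,t_0)t$, where $u^\varepsilon(\cdot;c,u_0,t_0)$ solves $\dot u^\varepsilon=f(u^\varepsilon/\varepsilon,t/\varepsilon,u_0,t_0)$, $u^\varepsilon(0)=c$. Then: (i) for all $t_1,t_2>0$ and $u_1,u_2\in\mathbb{R}$, \[|\bar f(u_1,t_1)-\bar f(u_2,t_2)|\leq \frac{2}{\Big\lfloor \frac{1}{\kappa}W\Big(\frac{1}{|u_1-u_2|+|t_1-t_2|}\Big)\Big\rfloor};\] (ii) for every $c\in\mathbb{R}$ there is a unique solution $\overline{u}(t;c)$ of $\dot{\overline u}=\bar f(\overline u,t)$, $t>0$, $\overline u(0)=c$; (iii) there is a constant $C>0$ depending only on $\|f\|_{W^{1,\infty}(\mathbb{R}^4)}$ such that, letting $u^\varepsilon(t;c)$ be the solution of $\dot u^\varepsilon=f(u^\varepsilon/\varepsilon,t/\varepsilon,u^\varepsilon,t)$, $u^\varepsilon(0)=c$, for $\varepsilon\in(0,1)$ and $c\in\mathbb{R}$: \[|u^\varepsilon(t;c)-\overline u(t;c)|\leq \frac{Ct}{|\log\varepsilon|}\ \text{ for } t>\varepsilon|\log\varepsilon|,\qquad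 |u^\varepsilon(t;c)-\overline u(t;c)|\leq \min\{C\varepsilon,2\|f\|_\infty t\}\ \text{ for } t\in[0,\varepsilon|\log\varepsilon|].\]
   Context: $W$ denotes the inverse of the map $x\mapsto xe^x$ on $[0,\infty)$ (Lambert W function); $\lfloor x\rfloor$ is the greatest integer $\le x$. When the floor in the denominator is $0$ (or $u_1=u_2,t_1=t_2$ trivially), the bound in (i) is understood as $+\infty$ resp. $0$ as appropriate. The existence of $\bar f(u_0,t_0)$ holds since for fixed $(u_0,t_0)$ the function $(r,\tau)\mapsto f(r,\tau,u_0,t_0)$ is $\mathbb{Z}^2$-periodic and Lipschitz. *)

theory Defs
  imports "HOL-Analysis.Analysis"
begin

definition lambertW :: "real \<Rightarrow> real" where
  "lambertW y = (THE x. 0 \<le> x \<and> x * exp x = y)"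

definition ode_sol :: "(real \<Rightarrow> real \<Rightarrow> real) \<Rightarrow> real \<Rightarrow> (real \<Rightarrow> real) \<Rightarrow> bool" where
  "ode_sol F c U \<longleftrightarrow> U 0 = c \<and> continuous_on {0..} U \<and>
     (\<forall>t>0. (U has_real_derivative F t (U t)) (at t))"

text \<open>f as a function on R^4 (nested pairs carry the Euclidean metric).\<close>
definition uncurry4 :: "(real \<Rightarrow> real \<Rightarrow> real \<Rightarrow> real \<Rightarrow> real) \<Rightarrow> real \<times> real \<times> real \<times> real \<Rightarrow> real" where
  "uncurry4 f = (\<lambda>(r, \<tau>, u, t). f r \<tau> u t)"

definition sup_norm :: "(real \<Rightarrow> real \<Rightarrow> real \<Rightarrow> real \<Rightarrow> real) \<Rightarrow> real" where
  "sup_norm f = (SUP x. \<bar>uncurry4 f x\<bar>)"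

text \<open>W^{1,inf} norm: sup norm plus the essential sup of |grad f| (= best Lipschitz constant).\<close>
definition w1inf_norm :: "(real \<Rightarrow> real \<Rightarrow> real \<Rightarrow> real \<Rightarrow> real) \<Rightarrow> real" where
  "w1inf_norm f = sup_norm f +
     (SUP p\<in>{(x, y). x \<noteq> y}. dist (uncurry4 f (fst p)) (uncurry4 f (snd p)) / dist (fst p) (snd p))"

end

theory Submission
  imports Defs
begin

text \<open>In the fast variables the frozen equation generates increasing maps that commute with
  integer translations, so \<open>fbar\<close> is a rotation number: a solution stays within distance 1 of its
  linear drift at all integer times. Two frozen equations whose coefficients differ by \<open>\<delta>\<close> have
  time-\<open>n\<close> maps that differ by at most 1 as long as \<open>\<delta> * (exp (\<kappa> * n) - 1) \<le> 1\<close>, and iterating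
  this gives \<open>\<bar>fbar1 - fbar2\<bar> \<le> 1 / n\<close>; the Lambert function selects the best \<open>n\<close>.

  For the rate, \<open>u\<^sup>\<epsilon>\<close> is cut into pieces of length \<open>\<epsilon> * n\<close> with \<open>n\<close> of order \<open>\<bar>ln \<epsilon>\<bar>\<close>, short enough
  for the frozen equation to be accurate up to \<open>O(\<epsilon>)\<close>. As \<open>fbar\<close> is non-increasing in \<open>u\<close>, the errors
  add up instead of being amplified, which gives a total error \<open>O(t / \<bar>ln \<epsilon>\<bar> + \<epsilon>)\<close>.\<close>

section \<open>Scalar differential equations on the half-line\<close>

text \<open>The witness \<open>t0\<close> is the last time at which \<open>w\<close> is nonpositive;
  from then on \<open>w\<close> is positive and the sign of the derivative of \<open>W\<close> is
  known. \<open>W\<close> is kept separate from \<open>w\<close> so that it can carry an exponential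
  weight or a linear correction.\<close>

lemma nonincreasing_since_last_nonpos:
  fixes w W :: "real \<Rightarrow> real"
  assumes "0 \<le> T" and w: "continuous_on {0..T} w" and W: "continuous_on {0..T} W"
    and w0: "w 0 \<le> 0" and wT: "w T > 0"
    and D: "\<And>t. 0 < t \<Longrightarrow> t < T \<Longrightarrow> w t > 0 \<Longrightarrow> \<exists>D. (W has_real_derivative D) (at t) \<and> D \<le> 0"
  obtains t0 where "0 \<le> t0" "t0 < T" "w t0 \<le> 0" "W T \<le> W t0"
proof -
  define S where "S = {0..T} \<inter> w -` {..0}"
  have "closed S"
    unfolding S_def using w by (intro continuous_closed_preimage) auto
  then have "compact S"
    using bounded_subset[OF bounded_closed_interval, of S 0 T] by (auto simp: S_def compact_eq_bounded_closed)
  moreover have "0 \<in> S"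
    using assms by (simp add: S_def)
  ultimately obtain t0 where t0: "t0 \<in> S" "\<And>t. t \<in> S \<Longrightarrow> t \<le> t0"
    using compact_attains_sup[of S] by blast
  have "t0 \<noteq> T"
    using t0(1) wT by (auto simp: S_def)
  then have lt: "0 \<le> t0" "t0 < T" "w t0 \<le> 0"
    using t0(1) by (auto simp: S_def)
  have pos: "w t > 0" if "t0 < t" "t < T" for t
    using t0(2)[of t] that lt by (force simp: S_def)
  have "W T \<le> W t0"
  proof (rule DERIV_nonpos_imp_decreasing_open[where f = W])
    show "continuous_on {t0..T} W"
      using W by (rule continuous_on_subset) (use lt in auto)
  qed (use lt pos D in auto)
  then show ?thesis
    using lt that by blast
qed

text \<open>The weighted quantity \<open>(w + \<delta>) * exp (- \<kappa> * t)\<close> cannot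
  increase while \<open>w\<close> is positive, and at the last nonpositive time of \<open>w\<close>
  it is at most \<delta>. Asking for the inequality only where \<open>w\<close> is positive avoids
  differentiating an absolute value.\<close>

lemma gronwall_pos_part:
  fixes w :: "real \<Rightarrow> real"
  assumes T: "0 \<le> T" and w: "continuous_on {0..T} w" and w0: "w 0 \<le> 0" and \<delta>: "0 \<le> \<delta>" and \<kappa>: "0 \<le> \<kappa>"
    and D: "\<And>t. 0 < t \<Longrightarrow> t < T \<Longrightarrow> w t > 0 \<Longrightarrow>
      \<exists>D. (w has_real_derivative D) (at t) \<and> D \<le> \<kappa> * (w t + \<delta>)"
  shows "w T \<le> \<delta> * (exp (\<kappa> * T) - 1)"
proof (cases "w T > 0")
  case True
  define W where "W t = (w t + \<delta>) * exp (- \<kappa> * t)" for t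
  have "continuous_on {0..T} W"
    unfolding W_def by (intro continuous_intros w)
  moreover have "\<exists>D. (W has_real_derivative D) (at t) \<and> D \<le> 0" if t: "0 < t" "t < T" "w t > 0" for t
  proof -
    obtain D where D: "(w has_real_derivative D) (at t)" "D \<le> \<kappa> * (w t + \<delta>)"
      using D t by blast
    have "(W has_real_derivative (D - \<kappa> * (w t + \<delta>)) * exp (- \<kappa> * t)) (at t)"
      unfolding W_def by (rule derivative_eq_intros D(1) refl)+ (simp add: algebra_simps)
    moreover have "(D - \<kappa> * (w t + \<delta>)) * exp (- \<kappa> * t) \<le> 0"
      using D(2) by (simp add: mult_nonpos_nonneg)
    ultimately show ?thesis by blast
  qed
  ultimately obtain t0 where t0: "0 \<le> t0" "t0 < T" "w t0 \<le> 0" "W T \<le> W t0"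
    using nonincreasing_since_last_nonpos[OF T w _ w0 True] by metis
  have "W t0 \<le> \<delta> * exp (- \<kappa> * t0)"
    unfolding W_def using t0 by (intro mult_right_mono) auto
  also have "\<dots> \<le> \<delta> * 1"
    using t0 \<kappa> \<delta> by (intro mult_left_mono) auto
  finally have "(w T + \<delta>) * exp (- \<kappa> * T) \<le> \<delta>"
    using t0 by (simp add: W_def)
  then have "(w T + \<delta>) * exp (- \<kappa> * T) * exp (\<kappa> * T) \<le> \<delta> * exp (\<kappa> * T)"
    by (intro mult_right_mono) auto
  moreover have "(w T + \<delta>) * exp (- \<kappa> * T) * exp (\<kappa> * T) = w T + \<delta>"
    by (simp add: mult.assoc flip: exp_add)
  ultimately have "w T + \<delta> \<le> \<delta> * exp (\<kappa> * T)"
    by linarith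
  then show ?thesis by (simp add: algebra_simps)
next
  case False
  have "0 \<le> \<delta> * (exp (\<kappa> * T) - 1)"
    using assms by simp
  then show ?thesis using False by linarith
qed

text \<open>Same argument with the correction \<open>w t - \<eta> * t\<close>. It serves equations
  with a non-increasing right-hand side, where no exponential factor appears.\<close>

lemma linear_growth_pos_part:
  fixes w :: "real \<Rightarrow> real"
  assumes T: "0 \<le> T" and w: "continuous_on {0..T} w" and w0: "w 0 \<le> 0" and \<eta>: "0 \<le> \<eta>"
    and D: "\<And>t. 0 < t \<Longrightarrow> t < T \<Longrightarrow> w t > 0 \<Longrightarrow>
      \<exists>D. (w has_real_derivative D) (at t) \<and> D \<le> \<eta>"
  shows "w T \<le> \<eta> * T"
proof (cases "w T > 0")
  case True
  define W where "W t = w t - \<eta> * t" for t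
  have "continuous_on {0..T} W"
    unfolding W_def by (intro continuous_intros w)
  moreover have "\<exists>D. (W has_real_derivative D) (at t) \<and> D \<le> 0" if t: "0 < t" "t < T" "w t > 0" for t
  proof -
    obtain D where D: "(w has_real_derivative D) (at t)" "D \<le> \<eta>"
      using D t by blast
    have "(W has_real_derivative (D - \<eta>)) (at t)"
      unfolding W_def by (rule derivative_eq_intros D(1) refl)+ simp
    then show ?thesis using D(2) by force
  qed
  ultimately obtain t0 where t0: "0 \<le> t0" "t0 < T" "w t0 \<le> 0" "W T \<le> W t0"
    using nonincreasing_since_last_nonpos[OF T w _ w0 True] by metis
  have "0 \<le> \<eta> * t0" using t0 \<eta> by simp
  then show ?thesis
    using t0 by (simp add: W_def)
next
  case False
  then show ?thesis using T \<eta> by (smt (verit) mult_nonneg_nonneg)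
qed

section \<open>Increments, comparison and stability of solutions\<close>

lemma ode_sol_cont: "ode_sol F c U \<Longrightarrow> continuous_on {0..T} U"
  unfolding ode_sol_def by (auto elim: continuous_on_subset)

lemma ode_sol_0: "ode_sol F c U \<Longrightarrow> U 0 = c"
  by (simp add: ode_sol_def)

lemma ode_sol_deriv: "ode_sol F c U \<Longrightarrow> 0 < t \<Longrightarrow> (U has_real_derivative F t (U t)) (at t)"
  by (simp add: ode_sol_def)

lemma continuous_deriv_increment_bound:
  fixes u :: "real \<Rightarrow> real"
  assumes "0 \<le> h" and u: "continuous_on {a..a + h} u"
    and D: "\<And>t. a < t \<Longrightarrow> t < a + h \<Longrightarrow> \<exists>D. (u has_real_derivative D) (at t) \<and> \<bar>D - q\<bar> \<le> \<eta>"
  shows "\<bar>u (a + h) - u a - h * q\<bar> \<le> \<eta> * h"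
proof -
  have "u (a + h) - (q + \<eta>) * (a + h) \<le> u a - (q + \<eta>) * a"
  proof (rule DERIV_nonpos_imp_decreasing_open[where f = "\<lambda>t. u t - (q + \<eta>) * t"])
    fix x assume "a < x" "x < a + h"
    then obtain D where D: "(u has_real_derivative D) (at x)" "\<bar>D - q\<bar> \<le> \<eta>"
      using D by blast
    have "((\<lambda>t. u t - (q + \<eta>) * t) has_real_derivative (D - (q + \<eta>))) (at x)"
      by (rule derivative_eq_intros D(1) refl)+ simp
    then show "\<exists>y. ((\<lambda>t. u t - (q + \<eta>) * t) has_real_derivative y) (at x) \<and> y \<le> 0"
      using D(2) by force
  qed (use assms in \<open>auto intro!: continuous_intros\<close>)
  moreover have "- u (a + h) + (q - \<eta>) * (a + h) \<le> - u a + (q - \<eta>) * a"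
  proof (rule DERIV_nonpos_imp_decreasing_open[where f = "\<lambda>t. - u t + (q - \<eta>) * t"])
    fix x assume "a < x" "x < a + h"
    then obtain D where D: "(u has_real_derivative D) (at x)" "\<bar>D - q\<bar> \<le> \<eta>"
      using D by blast
    have "((\<lambda>t. - u t + (q - \<eta>) * t) has_real_derivative (- D + (q - \<eta>))) (at x)"
      by (rule derivative_eq_intros D(1) refl)+ simp
    then show "\<exists>y. ((\<lambda>t. - u t + (q - \<eta>) * t) has_real_derivative y) (at x) \<and> y \<le> 0"
      using D(2) by force
  qed (use assms in \<open>auto intro!: continuous_intros\<close>)
  ultimately show ?thesis
    by (auto simp: algebra_simps abs_le_iff)
qed

lemma ode_sol_increment_bound:
  assumes U: "ode_sol F c U" and "0 \<le> a" "0 \<le> h"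
    and "\<And>t. a < t \<Longrightarrow> t < a + h \<Longrightarrow> \<bar>F t (U t) - q\<bar> \<le> \<eta>"
  shows "\<bar>U (a + h) - U a - h * q\<bar> \<le> \<eta> * h"
proof (rule continuous_deriv_increment_bound)
  show "continuous_on {a..a + h} U"
    using ode_sol_cont[OF U, of "a + h"] by (rule continuous_on_subset) (use assms in auto)
next
  fix t assume "a < t" "t < a + h"
  then show "\<exists>D. (U has_real_derivative D) (at t) \<and> \<bar>D - q\<bar> \<le> \<eta>"
    using assms ode_sol_deriv[OF U, of t] by force
qed fact

lemma ode_sol_lipschitz:
  assumes U: "ode_sol F c U" and F: "\<And>t x. \<bar>F t x\<bar> \<le> B" and "0 \<le> s" "0 \<le> t"
  shows "\<bar>U t - U s\<bar> \<le> B * \<bar>t - s\<bar>"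
proof -
  have *: "\<bar>U t - U s\<bar> \<le> B * (t - s)" if "0 \<le> s" "s \<le> t" for s t
    using ode_sol_increment_bound[OF U, of s "t - s" 0 B] that F by simp
  show ?thesis
    using *[of s t] *[of t s] assms by (cases "s \<le> t") (auto simp: abs_minus_commute)
qed

text \<open>Wherever \<open>U\<close> exceeds \<open>V\<close>, the derivative of the difference is
  at most \<open>G s (U s) - G s (V s)\<close>, hence at most \<open>L * (U s - V s)\<close>; the
  one-sided Gronwall estimate with \<delta> = 0 then excludes a positive gap.\<close>

lemma ode_sol_mono:
  assumes U: "ode_sol F a U" and V: "ode_sol G b V" and "a \<le> b" and t: "0 \<le> t"
    and FG: "\<And>t x. F t x \<le> G t x" and lip: "\<And>t x y. \<bar>G t x - G t y\<bar> \<le> L * \<bar>x - y\<bar>" and L: "0 \<le> L"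
  shows "U t \<le> V t"
proof -
  have "U t - V t \<le> 0 * (exp (L * t) - 1)"
  proof (rule gronwall_pos_part[where w = "\<lambda>t. U t - V t"])
    show "continuous_on {0..t} (\<lambda>t. U t - V t)"
      using U V by (intro continuous_intros ode_sol_cont)
    show "U 0 - V 0 \<le> 0"
      using assms by (simp add: ode_sol_0)
    fix s assume s: "0 < s" "s < t" "0 < U s - V s"
    have "F s (U s) - G s (V s) \<le> L * (U s - V s + 0)"
      using FG[of s "U s"] lip[of s "U s" "V s"] s by simp
    moreover have "((\<lambda>t. U t - V t) has_real_derivative F s (U s) - G s (V s)) (at s)"
      using s by (intro derivative_intros ode_sol_deriv[OF U] ode_sol_deriv[OF V])
    ultimately show "\<exists>D. ((\<lambda>t. U t - V t) has_real_derivative D) (at s) \<and> D \<le> L * (U s - V s + 0)"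
      by blast
  qed (use t L in auto)
  then show ?thesis by simp
qed

lemma ode_sol_unique:
  assumes "ode_sol F a U" "ode_sol F a V" "0 \<le> t"
    and "\<And>t x y. \<bar>F t x - F t y\<bar> \<le> L * \<bar>x - y\<bar>" "0 \<le> L"
  shows "U t = V t"
  using ode_sol_mono[OF assms(1,2) order_refl assms(3) order_refl assms(4,5)]
    ode_sol_mono[OF assms(2,1) order_refl assms(3) order_refl assms(4,5)]
  by (rule antisym)

text \<open>If \<open>U\<close> is above \<open>V\<close>, the non-increasing field \<open>H\<close>
  drives them together, so only the errors \<open>a\<close> and \<open>b\<close> can widen the gap.
  The bound involves no Lipschitz constant of \<open>H\<close>, which is what the merely continuous
  field \<open>fbar\<close> requires.\<close>

lemma ode_sol_decreasing_stability:
  assumes U: "ode_sol F c U" and V: "ode_sol G c V" and t: "0 \<le> t"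
    and H: "\<And>t x y. x \<le> y \<Longrightarrow> H t y \<le> (H t x :: real)"
    and F: "\<And>t x. \<bar>F t x - H t x\<bar> \<le> a" and G: "\<And>t x. \<bar>G t x - H t x\<bar> \<le> b"
  shows "\<bar>U t - V t\<bar> \<le> (a + b) * t"
proof -
  have *: "U t - V t \<le> (a + b) * t"
    if U: "ode_sol F c U" and V: "ode_sol G c V"
    and F: "\<And>t x. \<bar>F t x - H t x\<bar> \<le> a" and G: "\<And>t x. \<bar>G t x - H t x\<bar> \<le> b" for U V F G a b
  proof (rule linear_growth_pos_part[where w = "\<lambda>t. U t - V t"])
    show "continuous_on {0..t} (\<lambda>t. U t - V t)"
      using U V by (intro continuous_intros ode_sol_cont)
    show "U 0 - V 0 \<le> 0"
      using U V by (simp add: ode_sol_0)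
    show "0 \<le> a + b"
      using F[of 0 0] G[of 0 0] by linarith
    fix s assume s: "0 < s" "s < t" "0 < U s - V s"
    have "F s (U s) - G s (V s) \<le> a + b"
      using F[of s "U s"] G[of s "V s"] H[of "V s" "U s" s] s by linarith
    moreover have "((\<lambda>t. U t - V t) has_real_derivative F s (U s) - G s (V s)) (at s)"
      using s by (intro derivative_intros ode_sol_deriv[OF U] ode_sol_deriv[OF V])
    ultimately show "\<exists>D. ((\<lambda>t. U t - V t) has_real_derivative D) (at s) \<and> D \<le> a + b"
      by blast
  qed fact
  show ?thesis
    using *[OF U V F G] *[OF V U G F] by (simp add: abs_le_iff algebra_simps)
qed

section \<open>Global existence by contraction\<close>

lemma integral_deriv_half_line:
  fixes h :: "real \<Rightarrow> real"
  assumes h: "continuous_on {0..} h"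
  shows "continuous_on {0..} (\<lambda>t. integral {0..t} h)"
    and "0 < t \<Longrightarrow> ((\<lambda>t. integral {0..t} h) has_real_derivative h t) (at t)"
proof -
  \<comment> \<open>The compact interval ends at \<open>t + 1\<close>, so \<open>t\<close> is not
    its right endpoint and the one-sided derivative becomes two-sided for positive
    \<open>t\<close>.\<close>
  have *: "((\<lambda>t. integral {0..t} h) has_real_derivative h t) (at t within {0..t + 1})" if "0 \<le> t" for t
    using that by (intro integral_has_real_derivative continuous_on_subset[OF h]) auto
  show "continuous_on {0..} (\<lambda>t. integral {0..t} h)"
    unfolding continuous_on_eq_continuous_within
  proof
    fix t :: real assume "t \<in> {0..}"
    then have "continuous (at t within {0..t + 1}) (\<lambda>t. integral {0..t} h)"
      using *[of t] by (auto intro: DERIV_continuous)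
    moreover have "at t within {0..t + 1} = at t within {0..}"
      by (rule at_within_nhd[of t "{..<t + 1}"]) auto
    ultimately show "continuous (at t within {0..}) (\<lambda>t. integral {0..t} h)"
      by simp
  qed
  show "((\<lambda>t. integral {0..t} h) has_real_derivative h t) (at t)" if "0 < t"
    using *[of t] that by (simp add: at_within_Icc_at)
qed

text \<open>In the norm with weight \<open>exp (- 2 * L * t)\<close> the integral operator is a contraction
  with factor 1/2 on the whole half-line, so no continuation argument is needed.\<close>

lemma ode_sol_exists:
  fixes F :: "real \<Rightarrow> real \<Rightarrow> real"
  assumes cont: "continuous_on UNIV (\<lambda>(t, x). F t x)" and B: "\<And>t x. \<bar>F t x\<bar> \<le> B"
    and lip: "\<And>t x y. \<bar>F t x - F t y\<bar> \<le> L * \<bar>x - y\<bar>" and L: "0 < L"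
  shows "\<exists>U. ode_sol F c U"
proof -
  \<comment> \<open>The unknown \<phi> is the solution multiplied by
    \<open>exp (- 2 * L * s)\<close>; \<open>h\<close> removes this weight before evaluating
    \<open>F\<close>. In \<open>K\<close>, \<open>max 0 t\<close> extends the function by the
    constant \<open>c\<close> to negative times, so that it lies in the complete space of bounded
    continuous functions on the line.\<close>
  define h where "h \<phi> s = F s (exp (2 * L * s) * \<phi> s)" for \<phi> s
  define J where "J \<phi> t = integral {0..t} (h \<phi>)" for \<phi> t
  define K where "K \<phi> t = exp (- 2 * L * max 0 t) * (c + J \<phi> (max 0 t))" for \<phi> t
  have h_cont: "continuous_on A (h (apply_bcontfun \<phi>))" for A \<phi>
  proof -
    have "continuous_on UNIV ((\<lambda>(t, x). F t x) \<circ> (\<lambda>s. (s, exp (2 * L * s) * apply_bcontfun \<phi> s)))"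
      by (intro continuous_on_compose continuous_on_subset[OF cont] continuous_intros) auto
    then show ?thesis
      by (auto simp: h_def[abs_def] o_def intro: continuous_on_subset)
  qed
  have J_bound: "\<bar>J (apply_bcontfun \<phi>) t\<bar> \<le> B * t" if "0 \<le> t" for \<phi> t
    using integral_bound[of 0 t "h (apply_bcontfun \<phi>)" B] that h_cont B by (simp add: J_def h_def)
  have weight: "0 \<le> exp (- 2 * L * t) * t" "exp (- 2 * L * t) * t \<le> 1 / (2 * L)" if "0 \<le> t" for t
  proof -
    have "2 * L * t \<le> exp (2 * L * t)"
      using exp_ge_add_one_self[of "2 * L * t"] by linarith
    then show "exp (- 2 * L * t) * t \<le> 1 / (2 * L)"
      using L by (simp add: exp_minus field_simps)
  qed (use that in auto)
  have B0: "0 \<le> B" using B[of 0 0] by linarith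
  have K_bcont: "K (apply_bcontfun \<phi>) \<in> bcontfun" for \<phi>
  proof -
    have "continuous_on UNIV (\<lambda>t. J (apply_bcontfun \<phi>) (max 0 t))"
      unfolding J_def
      by (rule continuous_on_compose2[OF integral_deriv_half_line(1)[OF h_cont]])
        (auto intro!: continuous_intros)
    then have "continuous_on UNIV (K (apply_bcontfun \<phi>))"
      unfolding K_def[abs_def] by (intro continuous_intros)
    moreover have "\<bar>K (apply_bcontfun \<phi>) t\<bar> \<le> \<bar>c\<bar> + B * (1 / (2 * L))" for t
    proof -
      define s where "s = max 0 t"
      have s: "0 \<le> s" unfolding s_def by (rule max.cobounded1)
      have "\<bar>K (apply_bcontfun \<phi>) t\<bar> = exp (- 2 * L * s) * \<bar>c + J (apply_bcontfun \<phi>) s\<bar>"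
        by (simp add: K_def s_def abs_mult)
      also have "\<dots> \<le> exp (- 2 * L * s) * (\<bar>c\<bar> + B * s)"
        using J_bound[OF s, of \<phi>] by (intro mult_left_mono) auto
      also have "\<dots> = exp (- 2 * L * s) * \<bar>c\<bar> + B * (exp (- 2 * L * s) * s)"
        by (simp add: algebra_simps)
      also have "\<dots> \<le> 1 * \<bar>c\<bar> + B * (1 / (2 * L))"
        using weight[OF s] B0 L s by (intro add_mono mult_right_mono mult_left_mono) auto
      finally show ?thesis by simp
    qed
    ultimately show ?thesis
      by (auto simp: bcontfun_def bounded_iff)
  qed
  define \<Psi> where "\<Psi> \<phi> = Bcontfun (K (apply_bcontfun \<phi>))" for \<phi>
  have \<Psi>: "apply_bcontfun (\<Psi> \<phi>) = K (apply_bcontfun \<phi>)" for \<phi>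
    by (simp add: \<Psi>_def Bcontfun_inverse K_bcont)
  have "dist (\<Psi> \<phi>) (\<Psi> \<psi>) \<le> 1/2 * dist \<phi> \<psi>" for \<phi> \<psi>
  proof (rule dist_bound)
    fix t :: real
    define s where "s = max 0 t"
    define d where "d = dist \<phi> \<psi>"
    have s: "0 \<le> s" unfolding s_def by (rule max.cobounded1)
    \<comment> \<open>Integrating the Lipschitz factor \<open>L\<close> against a weight of exponent
      \<open>2 * L\<close> produces the contraction factor 1/2.\<close>
    have "((\<lambda>r. L * exp (2 * L * r) * d) has_integral exp (2 * L * s) / 2 * d - exp (2 * L * 0) / 2 * d) {0..s}"
    proof (rule fundamental_theorem_of_calculus[OF s])
      fix x
      have "((\<lambda>r. exp (2 * L * r) / 2 * d) has_real_derivative L * exp (2 * L * x) * d) (at x within {0..s})"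
        by (auto intro!: derivative_eq_intros)
      then show "((\<lambda>r. exp (2 * L * r) / 2 * d) has_vector_derivative L * exp (2 * L * x) * d) (at x within {0..s})"
        by (simp add: has_real_derivative_iff_has_vector_derivative)
    qed
    note I = this
    have "\<bar>J \<phi> s - J \<psi> s\<bar> = norm (integral {0..s} (\<lambda>r. h \<phi> r - h \<psi> r))"
      unfolding J_def by (subst integral_diff) (auto intro!: integrable_continuous_real h_cont)
    also have "\<dots> \<le> integral {0..s} (\<lambda>r. L * exp (2 * L * r) * d)"
    proof (rule integral_norm_bound_integral)
      fix r assume "r \<in> {0..s}"
      have "\<bar>h \<phi> r - h \<psi> r\<bar> \<le> L * \<bar>exp (2 * L * r) * \<phi> r - exp (2 * L * r) * \<psi> r\<bar>"
        unfolding h_def by (rule lip)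
      also have "\<dots> = L * exp (2 * L * r) * dist (\<phi> r) (\<psi> r)"
        by (simp add: dist_real_def right_diff_distrib[symmetric] abs_mult)
      also have "\<dots> \<le> L * exp (2 * L * r) * d"
        unfolding d_def using L by (intro mult_left_mono dist_bounded) auto
      finally show "norm (h \<phi> r - h \<psi> r) \<le> L * exp (2 * L * r) * d" by simp
    qed (use I in \<open>auto intro!: integrable_continuous_real continuous_intros h_cont\<close>)
    also have "\<dots> = exp (2 * L * s) / 2 * d - d / 2"
      using integral_unique[OF I] by simp
    also have "\<dots> \<le> exp (2 * L * s) / 2 * d"
      by (simp add: d_def)
    finally have J: "\<bar>J \<phi> s - J \<psi> s\<bar> \<le> exp (2 * L * s) / 2 * d" .
    have "dist (\<Psi> \<phi> t) (\<Psi> \<psi> t) = exp (- 2 * L * s) * \<bar>J \<phi> s - J \<psi> s\<bar>"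
      by (simp add: \<Psi> K_def s_def dist_real_def right_diff_distrib[symmetric] abs_mult)
    also have "\<dots> \<le> exp (- 2 * L * s) * (exp (2 * L * s) / 2 * d)"
      using J by (intro mult_left_mono) auto
    also have "\<dots> = 1/2 * d"
      by (simp add: exp_minus)
    finally show "dist (\<Psi> \<phi> t) (\<Psi> \<psi> t) \<le> 1/2 * dist \<phi> \<psi>"
      by (simp add: d_def)
  qed
  then obtain \<phi> where "\<Psi> \<phi> = \<phi>"
    using banach_fix_type[of "1/2" \<Psi>] by auto
  then have fixpoint: "K \<phi> t = \<phi> t" for t
    using \<Psi>[of \<phi>] by simp
  define U where "U t = c + J \<phi> t" for t
  \<comment> \<open>The fixed point equation says that \<phi> is the weighted \<open>U\<close>, so
    removing the weight gives the integral equation for \<open>U\<close>.\<close>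
  have h: "h \<phi> t = F t (U t)" if "0 \<le> t" for t
    using fixpoint[of t] that by (simp add: h_def K_def U_def exp_minus field_simps)
  have "ode_sol F c U"
    unfolding ode_sol_def
  proof (intro conjI allI impI)
    show "U 0 = c" by (simp add: U_def J_def)
    show "continuous_on {0..} U"
      unfolding U_def[abs_def] J_def by (intro continuous_intros integral_deriv_half_line(1) h_cont)
    fix t :: real assume "0 < t"
    then have "(J \<phi> has_real_derivative h \<phi> t) (at t)"
      unfolding J_def using integral_deriv_half_line(2)[OF h_cont] by blast
    then show "(U has_real_derivative F t (U t)) (at t)"
      unfolding U_def[abs_def] using \<open>0 < t\<close> h[of t]
      by (auto intro!: derivative_eq_intros simp: U_def[abs_def])
  qed
  then show ?thesis by (rule exI[of _ U])
qed

lemma lipschitz2_continuous: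
  fixes F :: "real \<Rightarrow> real \<Rightarrow> real"
  assumes lip: "\<And>t x t' x'. \<bar>F t x - F t' x'\<bar> \<le> L * (\<bar>t - t'\<bar> + \<bar>x - x'\<bar>)" and L: "0 < L"
  shows "continuous_on UNIV (\<lambda>(t, x). F t x)"
proof (rule lipschitz_on_continuous_on[OF lipschitz_onI])
  fix p q :: "real \<times> real"
  obtain t x t' x' where pq: "p = (t, x)" "q = (t', x')"
    by (cases p; cases q)
  have "\<bar>t - t'\<bar> + \<bar>x - x'\<bar> \<le> 2 * dist p q"
    using dist_fst_le[of p q] dist_snd_le[of p q] by (simp add: pq dist_real_def)
  then have "L * (\<bar>t - t'\<bar> + \<bar>x - x'\<bar>) \<le> L * (2 * dist p q)"
    using L by (intro mult_left_mono) auto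
  then show "dist (case p of (t, x) \<Rightarrow> F t x) (case q of (t, x) \<Rightarrow> F t x) \<le> (2 * L) * dist p q"
    using lip[of t x t' x'] by (simp add: pq dist_real_def)
qed (use L in auto)

lemma ode_sol_exists_lipschitz2:
  fixes F :: "real \<Rightarrow> real \<Rightarrow> real"
  assumes lip: "\<And>t x t' x'. \<bar>F t x - F t' x'\<bar> \<le> L * (\<bar>t - t'\<bar> + \<bar>x - x'\<bar>)" and L: "0 < L"
    and B: "\<And>t x. \<bar>F t x\<bar> \<le> B"
  shows "\<exists>U. ode_sol F c U"
proof (rule ode_sol_exists[OF lipschitz2_continuous[OF lip L] B _ L])
  show "\<bar>F t x - F t y\<bar> \<le> L * \<bar>x - y\<bar>" for t x y
    using lip[of t x t y] by simp
qed

section \<open>The frozen flow and its rotation number\<close>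

text \<open>The constants \<kappa> and \<open>B\<close> are parameters so that the same
  \<open>f\<close> can be treated with its own Lipschitz constant and also with constants computed
  from its norm. \<open>lip\<close> uses the sum of the coordinate distances, which dominates the
  Euclidean one.\<close>

locale averaging =
  fixes f :: "real \<Rightarrow> real \<Rightarrow> real \<Rightarrow> real \<Rightarrow> real" and \<kappa> B :: real and fbar :: "real \<Rightarrow> real \<Rightarrow> real"
  assumes \<kappa>: "0 < \<kappa>"
    and bound: "\<bar>f r \<tau> u t\<bar> \<le> B"
    and lip: "\<bar>f r \<tau> u t - f r' \<tau>' u' t'\<bar> \<le> \<kappa> * (\<bar>r - r'\<bar> + \<bar>\<tau> - \<tau>'\<bar> + \<bar>u - u'\<bar> + \<bar>t - t'\<bar>)"
    and per_r: "f (r + 1) \<tau> u t = f r \<tau> u t"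
    and per_\<tau>: "f r (\<tau> + 1) u t = f r \<tau> u t"
    and antimono: "u \<le> u' \<Longrightarrow> f r \<tau> u' t \<le> f r \<tau> u t"
    and average: "\<And>U :: real \<Rightarrow> real \<Rightarrow> real. 0 < t \<Longrightarrow>
      (\<And>\<epsilon>. 0 < \<epsilon> \<Longrightarrow> ode_sol (\<lambda>s x. f (x / \<epsilon>) (s / \<epsilon>) u0 t0) c (U \<epsilon>)) \<Longrightarrow>
      ((\<lambda>\<epsilon>. U \<epsilon> t) \<longlongrightarrow> c + fbar u0 t0 * t) (at_right 0)"
begin

text \<open>The flow in the fast variables (\<epsilon> = 1) with slow variables frozen at
  \<open>(u, t)\<close>, started from \<open>x\<close> at time 0. The choice is determined on
  nonnegative times by \<open>Y_sol\<close> and \<open>Y_unique\<close>.\<close>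

definition Y :: "real \<Rightarrow> real \<Rightarrow> real \<Rightarrow> real \<Rightarrow> real" where
  "Y u t x = (SOME U. ode_sol (\<lambda>s y. f y s u t) x U)"

lemma B_nonneg: "0 \<le> B"
  using bound[of 0 0 0 0] by linarith

lemma lip_r: "\<bar>f r \<tau> u t - f r' \<tau> u t\<bar> \<le> \<kappa> * \<bar>r - r'\<bar>"
  using lip[of r \<tau> u t r' \<tau> u t] by simp

lemma Y_sol: "ode_sol (\<lambda>s y. f y s u t) x (Y u t x)"
proof -
  have "\<bar>f y s u t - f y' s' u t\<bar> \<le> \<kappa> * (\<bar>s - s'\<bar> + \<bar>y - y'\<bar>)" for y s y' s'
    using lip[of y s u t y' s' u t] by (simp add: algebra_simps)
  then have "\<exists>U. ode_sol (\<lambda>s y. f y s u t) x U"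
    using \<kappa> bound by (rule ode_sol_exists_lipschitz2)
  then show ?thesis
    unfolding Y_def by (rule someI_ex)
qed

lemma Y_0 [simp]: "Y u t x 0 = x"
  using Y_sol by (rule ode_sol_0)

lemma Y_unique: "ode_sol (\<lambda>s y. f y s u t) x V \<Longrightarrow> 0 \<le> s \<Longrightarrow> V s = Y u t x s"
  by (rule ode_sol_unique[OF _ Y_sol _ lip_r]) (use \<kappa> in auto)

lemma Y_mono: "x \<le> y \<Longrightarrow> 0 \<le> s \<Longrightarrow> Y u t x s \<le> Y u t y s"
  by (rule ode_sol_mono[OF Y_sol Y_sol _ _ order_refl lip_r]) (use \<kappa> in auto)

lemma Y_antimono: "u \<le> u' \<Longrightarrow> 0 \<le> s \<Longrightarrow> Y u' t x s \<le> Y u t x s"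
  by (rule ode_sol_mono[OF Y_sol Y_sol order_refl _ antimono lip_r]) (use \<kappa> in auto)

lemma per_r_nat: "f (r + of_nat n) \<tau> u t = f r \<tau> u t"
proof (induction n)
  case (Suc n)
  then show ?case using per_r[of "r + of_nat n" \<tau> u t] by (simp add: algebra_simps)
qed simp

lemma per_r_int: "f (r + of_int k) \<tau> u t = f r \<tau> u t"
proof (cases "0 \<le> k")
  case True
  then show ?thesis using per_r_nat[of r "nat k"] by simp
next
  case False
  then show ?thesis using per_r_nat[of "r + of_int k" "nat (- k)"] by simp
qed

lemma per_\<tau>_nat: "f r (\<tau> + of_nat n) u t = f r \<tau> u t"
proof (induction n)
  case (Suc n)
  then show ?case using per_\<tau>[of r "\<tau> + of_nat n" u t] by (simp add: algebra_simps)
qed simp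

text \<open>Periodicity in \<open>r\<close> makes an integer translate of a solution again a
  solution, so uniqueness identifies the two curves.\<close>

lemma Y_add_int: "0 \<le> s \<Longrightarrow> Y u t (x + of_int k) s = Y u t x s + of_int k"
proof (rule Y_unique[symmetric])
  show "ode_sol (\<lambda>s y. f y s u t) (x + of_int k) (\<lambda>s. Y u t x s + of_int k)"
    using Y_sol[of u t x] unfolding ode_sol_def
    by (auto intro!: continuous_intros derivative_eq_intros simp: per_r_int)
qed

text \<open>The clock may be reset at integer times because \<open>f\<close> has period 1 in \<tau>;
  thus the time-\<open>m * n\<close> map is the \<open>m\<close>-th iterate of the
  time-\<open>n\<close> map.\<close>

lemma Y_add_time:
  assumes "0 \<le> s"
  shows "Y u t x (s + real n) = Y u t (Y u t x (real n)) s"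
proof (rule Y_unique[OF _ assms])
  show "ode_sol (\<lambda>s y. f y s u t) (Y u t x (real n)) (\<lambda>s. Y u t x (s + real n))"
    unfolding ode_sol_def
  proof (intro conjI allI impI)
    have "continuous_on {0..} (Y u t x)"
      using Y_sol by (simp add: ode_sol_def)
    then show "continuous_on {0..} (\<lambda>s. Y u t x (s + real n))"
      by (rule continuous_on_compose2) (auto intro!: continuous_intros)
    fix s :: real assume "0 < s"
    then have "(Y u t x has_real_derivative f (Y u t x (s + real n)) s u t) (at (s + real n))"
      using ode_sol_deriv[OF Y_sol, of "s + real n" u t x] by (simp add: per_\<tau>_nat)
    then show "((\<lambda>s. Y u t x (s + real n)) has_real_derivative f (Y u t x (s + real n)) s u t) (at s)"
      by (simp add: DERIV_shift)
  qed simp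
qed

section \<open>\<open>fbar\<close> as a rotation number\<close>

lemma Y_avg:
  assumes n: "0 < n"
  shows "(\<lambda>m. Y u t 0 (real (m * n)) / real m) \<longlonglongrightarrow> real n * fbar u t"
proof -
  have "((\<lambda>\<epsilon>. \<epsilon> * Y u t 0 (1 / \<epsilon>)) \<longlongrightarrow> 0 + fbar u t * 1) (at_right 0)"
  proof (rule average)
    fix \<epsilon> :: real assume \<epsilon>: "0 < \<epsilon>"
    show "ode_sol (\<lambda>s x. f (x / \<epsilon>) (s / \<epsilon>) u t) 0 (\<lambda>s. \<epsilon> * Y u t 0 (s / \<epsilon>))"
      unfolding ode_sol_def
    proof (intro conjI allI impI)
      have "continuous_on {0..} (Y u t 0)"
        using Y_sol by (simp add: ode_sol_def)
      then have "continuous_on {0..} (\<lambda>s. Y u t 0 (s / \<epsilon>))"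
        by (rule continuous_on_compose2) (use \<epsilon> in \<open>auto intro!: continuous_intros\<close>)
      then show "continuous_on {0..} (\<lambda>s. \<epsilon> * Y u t 0 (s / \<epsilon>))"
        by (intro continuous_intros)
      fix s :: real assume "0 < s"
      then have "(Y u t 0 has_real_derivative f (Y u t 0 (s / \<epsilon>)) (s / \<epsilon>) u t) (at (s / \<epsilon>))"
        using ode_sol_deriv[OF Y_sol, of "s / \<epsilon>" u t 0] \<epsilon> by simp
      then have "((\<lambda>s. Y u t 0 (s / \<epsilon>)) has_real_derivative f (Y u t 0 (s / \<epsilon>)) (s / \<epsilon>) u t * (1 / \<epsilon>)) (at s)"
        by (rule DERIV_chain2) (use \<epsilon> in \<open>auto intro!: derivative_eq_intros\<close>)
      then have "((\<lambda>s. \<epsilon> * Y u t 0 (s / \<epsilon>)) has_real_derivative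
          \<epsilon> * (f (Y u t 0 (s / \<epsilon>)) (s / \<epsilon>) u t * (1 / \<epsilon>))) (at s)"
        by (rule DERIV_cmult)
      then show "((\<lambda>s. \<epsilon> * Y u t 0 (s / \<epsilon>)) has_real_derivative
          f (\<epsilon> * Y u t 0 (s / \<epsilon>) / \<epsilon>) (s / \<epsilon>) u t) (at s)"
        using \<epsilon> by simp
    qed simp
  qed simp
  then have lim: "((\<lambda>\<epsilon>. \<epsilon> * Y u t 0 (1 / \<epsilon>)) \<longlongrightarrow> fbar u t) (at_right 0)"
    by simp
  have "filterlim (\<lambda>m. 1 / real (m * n)) (at_right 0) sequentially"
    unfolding filterlim_at
  proof
    have "(\<lambda>m. (1 / real n) * inverse (real m)) \<longlonglongrightarrow> (1 / real n) * 0"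
      by (intro tendsto_intros lim_inverse_n)
    then show "(\<lambda>m. 1 / real (m * n)) \<longlonglongrightarrow> 0"
      by (simp add: field_simps)
    show "\<forall>\<^sub>F m in sequentially. 1 / real (m * n) \<in> {0<..} \<and> 1 / real (m * n) \<noteq> 0"
      using eventually_gt_at_top[of 0] by eventually_elim (use n in auto)
  qed
  from filterlim_compose[OF lim this]
  have "(\<lambda>m. real n * (1 / real (m * n) * Y u t 0 (1 / (1 / real (m * n))))) \<longlonglongrightarrow> real n * fbar u t"
    by (intro tendsto_intros)
  then show ?thesis
    using n by (simp add: field_simps)
qed

text \<open>The offset \<open>C\<close> disappears on division by \<open>m\<close>, so bounds along
  the iterates need only hold up to a constant, such as the one caused by changing the starting
  point.\<close>

lemma fbar_upper:
  assumes n: "0 < n" and le: "\<And>m. Y u t 0 (real (m * n)) \<le> C + real m * K"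
  shows "real n * fbar u t \<le> K"
proof (rule LIMSEQ_le[OF Y_avg[OF n]])
  have "(\<lambda>m. C * inverse (real m) + K) \<longlonglongrightarrow> C * 0 + K"
    by (intro tendsto_intros lim_inverse_n)
  then show "(\<lambda>m. C * inverse (real m) + K) \<longlonglongrightarrow> K" by simp
  have frac: "(C + real m * K) / real m = C * inverse (real m) + K" if "1 \<le> m" for m
    using that by (simp add: field_simps)
  have "Y u t 0 (real (m * n)) / real m \<le> C * inverse (real m) + K" if "1 \<le> m" for m
    using divide_right_mono[OF le[of m], of "real m"] frac[OF that] by simp
  then show "\<exists>N. \<forall>m\<ge>N. Y u t 0 (real (m * n)) / real m \<le> C * inverse (real m) + K"
    by blast
qed

lemma fbar_lower:
  assumes n: "0 < n" and le: "\<And>m. C + real m * K \<le> Y u t 0 (real (m * n))"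
  shows "K \<le> real n * fbar u t"
proof (rule LIMSEQ_le[OF _ Y_avg[OF n]])
  have "(\<lambda>m. C * inverse (real m) + K) \<longlonglongrightarrow> C * 0 + K"
    by (intro tendsto_intros lim_inverse_n)
  then show "(\<lambda>m. C * inverse (real m) + K) \<longlonglongrightarrow> K" by simp
  have frac: "(C + real m * K) / real m = C * inverse (real m) + K" if "1 \<le> m" for m
    using that by (simp add: field_simps)
  have "C * inverse (real m) + K \<le> Y u t 0 (real (m * n)) / real m" if "1 \<le> m" for m
    using divide_right_mono[OF le[of m], of "real m"] frac[OF that] by simp
  then show "\<exists>N. \<forall>m\<ge>N. C * inverse (real m) + K \<le> Y u t 0 (real (m * n)) / real m"
    by blast
qed

lemma fbar_bound: "\<bar>fbar u t\<bar> \<le> B"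
proof -
  have "\<bar>Y u t 0 (real m)\<bar> \<le> B * real m" for m
    using ode_sol_lipschitz[OF Y_sol bound, of 0 "real m" u t 0] by simp
  then have "\<bar>Y u t 0 (real (m * 1))\<bar> \<le> real m * B" for m
    by (simp add: mult.commute)
  then have le: "Y u t 0 (real (m * 1)) \<le> 0 + real m * B" "0 + real m * - B \<le> Y u t 0 (real (m * 1))" for m
    by (simp_all add: abs_le_iff minus_le_iff)
  have "real 1 * fbar u t \<le> B"
    by (rule fbar_upper[OF _ le(1)]) simp
  moreover have "- B \<le> real 1 * fbar u t"
    by (rule fbar_lower[OF _ le(2)]) simp
  ultimately  show ?thesis by (simp add: abs_le_iff)
qed

lemma fbar_antimono:
  assumes "u \<le> u'"
  shows "fbar u' t \<le> fbar u t"
proof -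
  have "Y u' t 0 (real (m * 1)) / real m \<le> Y u t 0 (real (m * 1)) / real m" for m
    using assms by (intro divide_right_mono Y_antimono) auto
  then show ?thesis
    using LIMSEQ_le[OF Y_avg[of 1 u' t] Y_avg[of 1 u t]] by simp
qed

text \<open>Since the flow is increasing and commutes with integer translations, a bound on one step
  by an integer translation propagates to all iterates. This is why \<open>K\<close> is an
  integer.\<close>

lemma Y_iterate_upper:
  assumes "Y u t x (real n) \<le> x + of_int K"
  shows "Y u t x (real (m * n)) \<le> x + of_int (int m * K)"
proof (induction m)
  case (Suc m)
  have "Y u t x (real (Suc m * n)) = Y u t (Y u t x (real n)) (real (m * n))"
    using Y_add_time[of "real (m * n)" u t x n] by (simp add: algebra_simps)
  also have "\<dots> \<le> Y u t (x + of_int K) (real (m * n))"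
    using assms by (intro Y_mono) auto
  also have "\<dots> = Y u t x (real (m * n)) + of_int K"
    by (intro Y_add_int) auto
  finally show ?case using Suc by (simp add: algebra_simps)
qed simp

lemma Y_iterate_lower:
  assumes "x + of_int K \<le> Y u t x (real n)"
  shows "x + of_int (int m * K) \<le> Y u t x (real (m * n))"
proof (induction m)
  case (Suc m)
  have "Y u t x (real (m * n)) + of_int K = Y u t (x + of_int K) (real (m * n))"
    by (intro Y_add_int[symmetric]) auto
  also have "\<dots> \<le> Y u t (Y u t x (real n)) (real (m * n))"
    using assms by (intro Y_mono) auto
  also have "\<dots> = Y u t x (real (Suc m * n))"
    using Y_add_time[of "real (m * n)" u t x n] by (simp add: algebra_simps)
  finally show ?case using Suc by (simp add: algebra_simps)
qed simp

text \<open>Rounding the displacement up and down to integers and iterating both bounds shows that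
  \<open>real n * fbar u t\<close> lies between the same floor and ceiling as the displacement, so
  the two differ by at most 1.\<close>

lemma Y_deviation: "\<bar>Y u t x (real n) - x - real n * fbar u t\<bar> \<le> 1"
proof (cases "n = 0")
  case False
  then have n: "0 < n" by simp
  define K where "K = \<lceil>Y u t x (real n) - x\<rceil>"
  have "real n * fbar u t \<le> of_int K"
  proof (rule fbar_upper[OF n])
    fix m
    \<comment> \<open>The starting point 0 lies below an integer translate of \<open>x\<close>; the
      translation only costs a constant independent of \<open>m\<close>.\<close>
    have "Y u t 0 (real (m * n)) \<le> Y u t (x + of_int \<lceil>- x\<rceil>) (real (m * n))"
      by (rule Y_mono) linarith+
    also have "\<dots> = Y u t x (real (m * n)) + of_int \<lceil>- x\<rceil>"
      by (intro Y_add_int) auto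
    also have "Y u t x (real (m * n)) \<le> x + of_int (int m * K)"
      by (rule Y_iterate_upper) (simp add: K_def, linarith)
    finally show "Y u t 0 (real (m * n)) \<le> (x + of_int \<lceil>- x\<rceil>) + real m * of_int K"
      by simp
  qed
  moreover define K' where "K' = \<lfloor>Y u t x (real n) - x\<rfloor>"
  have "of_int K' \<le> real n * fbar u t"
  proof (rule fbar_lower[OF n])
    fix m
    have "x + of_int (int m * K') \<le> Y u t x (real (m * n))"
      by (rule Y_iterate_lower) (simp add: K'_def, linarith)
    then have "(x + of_int \<lfloor>- x\<rfloor>) + real m * of_int K' \<le> Y u t x (real (m * n)) + of_int \<lfloor>- x\<rfloor>"
      by simp
    also have "\<dots> = Y u t (x + of_int \<lfloor>- x\<rfloor>) (real (m * n))"
      by (intro Y_add_int[symmetric]) auto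
    also have "\<dots> \<le> Y u t 0 (real (m * n))"
      by (rule Y_mono) linarith+
    finally show "(x + of_int \<lfloor>- x\<rfloor>) + real m * of_int K' \<le> Y u t 0 (real (m * n))" .
  qed
  ultimately show ?thesis
    unfolding K_def K'_def by linarith
qed simp

section \<open>Dependence on the slow variables\<close>

text \<open>Gronwall applied to both signs of the difference. The slow arguments \<open>p\<close>,
  \<open>q\<close> along \<open>V\<close> may vary with time, so the lemma covers two frozen flows
  as well as the full solution seen in fast variables.\<close>

lemma Y_compare:
  assumes T: "0 \<le> T" and V: "continuous_on {0..T} V" and \<delta>: "0 \<le> \<delta>"
    and D: "\<And>s. 0 < s \<Longrightarrow> s < T \<Longrightarrow> \<exists>p q. (V has_real_derivative f (V s) s p q) (at s) \<and> \<bar>p - u\<bar> + \<bar>q - t\<bar> \<le> \<delta>"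
  shows "\<bar>V T - Y u t (V 0) T\<bar> \<le> \<delta> * (exp (\<kappa> * T) - 1)"
proof -
  let ?y = "Y u t (V 0)"
  have *: "\<exists>D. ((\<lambda>s. V s - ?y s) has_real_derivative D) (at s) \<and> \<bar>D\<bar> \<le> \<kappa> * (\<bar>V s - ?y s\<bar> + \<delta>)"
    if s: "0 < s" "s < T" for s
  proof -
    obtain p q where pq: "(V has_real_derivative f (V s) s p q) (at s)" "\<bar>p - u\<bar> + \<bar>q - t\<bar> \<le> \<delta>"
      using D s by blast
    have "\<bar>f (V s) s p q - f (?y s) s u t\<bar> \<le> \<kappa> * (\<bar>V s - ?y s\<bar> + \<bar>s - s\<bar> + \<bar>p - u\<bar> + \<bar>q - t\<bar>)"
      by (rule lip)
    also have "\<dots> \<le> \<kappa> * (\<bar>V s - ?y s\<bar> + \<delta>)"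
      using pq \<kappa> by (intro mult_left_mono) auto
    finally have "\<bar>f (V s) s p q - f (?y s) s u t\<bar> \<le> \<kappa> * (\<bar>V s - ?y s\<bar> + \<delta>)" .
    moreover have "((\<lambda>s. V s - ?y s) has_real_derivative f (V s) s p q - f (?y s) s u t) (at s)"
      using s by (intro derivative_intros pq(1) ode_sol_deriv[OF Y_sol])
    ultimately show ?thesis by blast
  qed
  have y: "continuous_on {0..T} ?y"
    by (rule ode_sol_cont[OF Y_sol])
  have "V T - ?y T \<le> \<delta> * (exp (\<kappa> * T) - 1)"
  proof (rule gronwall_pos_part[OF T, where w = "\<lambda>s. V s - ?y s"])
    fix s assume s: "0 < s" "s < T" "0 < V s - ?y s"
    then show "\<exists>D. ((\<lambda>s. V s - ?y s) has_real_derivative D) (at s) \<and> D \<le> \<kappa> * (V s - ?y s + \<delta>)"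
      using *[of s] by (auto simp: abs_le_iff)
  qed (use V y \<delta> \<kappa> in \<open>auto intro!: continuous_intros\<close>)
  moreover have "?y T - V T \<le> \<delta> * (exp (\<kappa> * T) - 1)"
  proof (rule gronwall_pos_part[OF T, where w = "\<lambda>s. ?y s - V s"])
    fix s assume s: "0 < s" "s < T" "0 < ?y s - V s"
    then obtain D where D: "((\<lambda>s. V s - ?y s) has_real_derivative D) (at s)" "\<bar>D\<bar> \<le> \<kappa> * (\<bar>V s - ?y s\<bar> + \<delta>)"
      using *[of s] by blast
    have "((\<lambda>s. ?y s - V s) has_real_derivative - D) (at s)"
      using DERIV_minus[OF D(1)] by simp
    moreover have "- D \<le> \<kappa> * (?y s - V s + \<delta>)"
      using D(2) s by (simp add: abs_le_iff)
    ultimately show "\<exists>D. ((\<lambda>s. ?y s - V s) has_real_derivative D) (at s) \<and> D \<le> \<kappa> * (?y s - V s + \<delta>)"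
      by blast
  qed (use V y \<delta> \<kappa> in \<open>auto intro!: continuous_intros\<close>)
  ultimately show ?thesis by (simp add: abs_le_iff)
qed

lemma Y_diff:
  assumes "0 \<le> s"
  shows "\<bar>Y u1 t1 x s - Y u2 t2 x s\<bar> \<le> (\<bar>u1 - u2\<bar> + \<bar>t1 - t2\<bar>) * (exp (\<kappa> * s) - 1)"
  using Y_compare[OF assms ode_sol_cont[OF Y_sol[of u1 t1 x]], of "\<bar>u1 - u2\<bar> + \<bar>t1 - t2\<bar>" u2 t2]
    ode_sol_deriv[OF Y_sol[of u1 t1 x]] by fastforce

text \<open>The time-\<open>n\<close> maps are increasing and commute with integer translations, so a pointwise
  gap of at most 1 between two of them grows at most linearly under iteration.\<close>

lemma fbar_diff_le:
  assumes n: "0 < n" and gap: "(\<bar>u1 - u2\<bar> + \<bar>t1 - t2\<bar>) * (exp (\<kappa> * real n) - 1) \<le> 1"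
  shows "\<bar>fbar u1 t1 - fbar u2 t2\<bar> \<le> 1 / real n"
proof -
  have *: "fbar u1 t1 - fbar u2 t2 \<le> 1 / real n"
    if gap: "(\<bar>u1 - u2\<bar> + \<bar>t1 - t2\<bar>) * (exp (\<kappa> * real n) - 1) \<le> 1" for u1 t1 u2 t2
  proof -
    have step: "Y u1 t1 x (real n) \<le> Y u2 t2 x (real n) + 1" for x
      using Y_diff[of "real n" u1 t1 x u2 t2] gap by simp
    have iter: "Y u1 t1 0 (real (m * n)) \<le> Y u2 t2 0 (real (m * n)) + real m" for m
    proof -
      have "Y u1 t1 x (real (m * n)) \<le> Y u2 t2 x (real (m * n)) + real m" for x
      proof (induction m arbitrary: x)
        case (Suc m)
        have "Y u1 t1 x (real (Suc m * n)) = Y u1 t1 (Y u1 t1 x (real n)) (real (m * n))"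
          using Y_add_time[of "real (m * n)" u1 t1 x n] by (simp add: algebra_simps)
        also have "\<dots> \<le> Y u1 t1 (Y u2 t2 x (real n) + of_int 1) (real (m * n))"
          using step[of x] by (intro Y_mono) auto
        also have "\<dots> = Y u1 t1 (Y u2 t2 x (real n)) (real (m * n)) + of_int 1"
          by (intro Y_add_int) auto
        also have "Y u1 t1 (Y u2 t2 x (real n)) (real (m * n))
            \<le> Y u2 t2 (Y u2 t2 x (real n)) (real (m * n)) + real m"
          by (rule Suc)
        also have "Y u2 t2 (Y u2 t2 x (real n)) (real (m * n)) = Y u2 t2 x (real (Suc m * n))"
          using Y_add_time[of "real (m * n)" u2 t2 x n] by (simp add: algebra_simps)
        finally show ?case by simp
      qed simp
      then show ?thesis .
    qed
    have "real n * fbar u1 t1 \<le> real n * fbar u2 t2 + 1"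
    proof (rule LIMSEQ_le[OF Y_avg[OF n] tendsto_add[OF Y_avg[OF n] tendsto_const]])
      have "Y u1 t1 0 (real (m * n)) / real m \<le> Y u2 t2 0 (real (m * n)) / real m + 1" if "1 \<le> m" for m
        using iter[of m] that by (simp add: field_simps)
      then show "\<exists>N. \<forall>m\<ge>N. Y u1 t1 0 (real (m * n)) / real m \<le> Y u2 t2 0 (real (m * n)) / real m + 1"
        by blast
    qed
    then show ?thesis
      using n by (simp add: field_simps)
  qed
  have "(\<bar>u2 - u1\<bar> + \<bar>t2 - t1\<bar>) * (exp (\<kappa> * real n) - 1) \<le> 1"
    using gap by (simp add: abs_minus_commute)
  then show ?thesis
    using *[OF gap] *[of u2 u1 t2 t1] by (simp add: abs_le_iff)
qed

end

section \<open>The averaged equation\<close>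

context averaging
begin

text \<open>Choose \<open>n\<close> with \<open>1 / n\<close> below \<eta>; then
  \<open>\<delta> = 1 / (exp (\<kappa> * n) - 1)\<close> is exactly the gap allowed by
  \<open>fbar_diff_le\<close>.\<close>

lemma fbar_uniformly_continuous:
  assumes "0 < \<eta>"
  obtains \<delta> where "0 < \<delta>"
    "\<And>u1 t1 u2 t2. \<bar>u1 - u2\<bar> + \<bar>t1 - t2\<bar> \<le> \<delta> \<Longrightarrow> \<bar>fbar u1 t1 - fbar u2 t2\<bar> \<le> \<eta>"
proof -
  obtain n where n: "0 < n" "inverse (real n) < \<eta>"
    using ex_inverse_of_nat_less[OF assms] by blast
  define E where "E = exp (\<kappa> * real n) - 1"
  have E: "0 < E" using n \<kappa> by (simp add: E_def)
  have "\<bar>fbar u1 t1 - fbar u2 t2\<bar> \<le> \<eta>" if "\<bar>u1 - u2\<bar> + \<bar>t1 - t2\<bar> \<le> 1 / E" for u1 t1 u2 t2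
  proof -
    have "(\<bar>u1 - u2\<bar> + \<bar>t1 - t2\<bar>) * E \<le> 1"
      using that E by (simp add: field_simps)
    then have "\<bar>fbar u1 t1 - fbar u2 t2\<bar> \<le> 1 / real n"
      unfolding E_def by (rule fbar_diff_le[OF n(1)])
    then show ?thesis using n(2) by (simp add: inverse_eq_divide)
  qed
  then show ?thesis using E by (intro that[of "1 / E"]) auto
qed

text \<open>The finite-time averages are Lipschitz in \<open>(u, t)\<close>, unlike \<open>fbar\<close>, so their equations can be
  solved by Picard iteration; monotonicity then lets the solutions converge.\<close>

lemma finite_average_error:
  assumes "0 < n"
  shows "\<bar>Y u t 0 (real n) / real n - fbar u t\<bar> \<le> 1 / real n"
proof -
  have "Y u t 0 (real n) / real n - fbar u t = (Y u t 0 (real n) - 0 - real n * fbar u t) / real n"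
    using assms by (simp add: field_simps)
  also have "\<bar>\<dots>\<bar> \<le> 1 / real n"
    using Y_deviation[of u t 0 n] unfolding abs_divide by (simp add: divide_right_mono)
  finally show ?thesis .
qed

lemma finite_average_sol_exists:
  assumes n: "0 < n"
  shows "\<exists>U. ode_sol (\<lambda>t x. Y x t 0 (real n) / real n) c U"
proof (rule ode_sol_exists_lipschitz2[where L = "(exp (\<kappa> * real n) - 1) / real n" and B = B])
  show "0 < (exp (\<kappa> * real n) - 1) / real n"
    using n \<kappa> by simp
  show "\<bar>Y x t 0 (real n) / real n\<bar> \<le> B" for t x
    using ode_sol_lipschitz[OF Y_sol bound, of 0 "real n" x t 0] n by (simp add: field_simps)
  show "\<bar>Y x t 0 (real n) / real n - Y x' t' 0 (real n) / real n\<bar>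
      \<le> (exp (\<kappa> * real n) - 1) / real n * (\<bar>t - t'\<bar> + \<bar>x - x'\<bar>)" for t x t' x'
  proof -
    have "\<bar>Y x t 0 (real n) - Y x' t' 0 (real n)\<bar> / real n
        \<le> ((\<bar>x - x'\<bar> + \<bar>t - t'\<bar>) * (exp (\<kappa> * real n) - 1)) / real n"
      using Y_diff[of "real n" x t 0 x' t'] by (intro divide_right_mono) auto
    then show ?thesis
      by (simp add: diff_divide_distrib[symmetric] abs_divide ac_simps)
  qed
qed

text \<open>The fields \<open>G n\<close> lie within \<open>1 / (n + 1)\<close> of the
  non-increasing \<open>fbar\<close>, so stability makes their solutions Cauchy at each time. On
  bounded intervals the derivatives also converge uniformly, which transfers the equation to the
  limit \<open>V\<close>.\<close>

lemma averaged_sol_exists: "\<exists>U. ode_sol (\<lambda>t x. fbar x t) c U"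
proof -
  define G where "G n t x = Y x t 0 (real (Suc n)) / real (Suc n)" for n t x
  have G: "\<bar>G n t x - fbar x t\<bar> \<le> 1 / real (Suc n)" for n t x
    unfolding G_def by (rule finite_average_error) simp
  have "\<exists>U. ode_sol (G n) c U" for n
    using finite_average_sol_exists[of "Suc n" c] by (simp add: G_def[abs_def])
  then obtain U where U: "\<And>n. ode_sol (G n) c (U n)"
    by metis
  have diff: "\<bar>U n t - U m t\<bar> \<le> (1 / real (Suc n) + 1 / real (Suc m)) * t" if "0 \<le> t" for n m t
    by (rule ode_sol_decreasing_stability[OF U U that _ G G]) (rule fbar_antimono)
  have "Cauchy (\<lambda>n. U n t)" if t: "0 \<le> t" for t
  proof (rule CauchyI')
    fix e :: real assume "0 < e"
    \<comment> \<open>The \<open>t + 1\<close> in the denominator keeps it positive at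
      \<open>t = 0\<close>.\<close>
    then obtain N where N: "inverse (real (Suc N)) < e / (2 * (t + 1))"
      using reals_Archimedean[of "e / (2 * (t + 1))"] t by auto
    have "dist (U m t) (U n t) < e" if "m \<ge> N" "n > m" for m n
    proof -
      have "1 / real (Suc m) + 1 / real (Suc n) \<le> 1 / real (Suc N) + 1 / real (Suc N)"
        using that by (intro add_mono divide_left_mono) auto
      then have "(1 / real (Suc m) + 1 / real (Suc n)) * t \<le> (1 / real (Suc N) + 1 / real (Suc N)) * (t + 1)"
        using t by (intro mult_mono) auto
      also have "\<dots> = inverse (real (Suc N)) * (2 * (t + 1))"
        by (simp add: inverse_eq_divide)
      also have "\<dots> < e"
        using N t by (simp add: pos_less_divide_eq)
      finally show ?thesis
        using diff[OF t, of m n] by (simp add: dist_real_def)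
    qed
    then show "\<exists>M. \<forall>m\<ge>M. \<forall>n>m. dist (U m t) (U n t) < e"
      by (intro exI[of _ N]) simp
  qed
  then have "\<exists>l. (\<lambda>n. U n t) \<longlonglongrightarrow> l" if "0 \<le> t" for t
    using that by (simp add: real_Cauchy_convergent convergentD)
  then obtain V where V: "\<And>t. 0 \<le> t \<Longrightarrow> (\<lambda>n. U n t) \<longlonglongrightarrow> V t"
    by metis
  have VU: "\<bar>U n t - V t\<bar> \<le> 1 / real (Suc n) * t" if t: "0 \<le> t" for n t
  proof (rule LIMSEQ_le)
    show "(\<lambda>m. \<bar>U n t - U m t\<bar>) \<longlonglongrightarrow> \<bar>U n t - V t\<bar>"
      by (intro tendsto_intros V t)
    have "(\<lambda>m. (1 / real (Suc n) + inverse (real (Suc m))) * t) \<longlonglongrightarrow> (1 / real (Suc n) + 0) * t"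
      by (intro tendsto_intros LIMSEQ_inverse_real_of_nat)
    then show "(\<lambda>m. (1 / real (Suc n) + inverse (real (Suc m))) * t) \<longlonglongrightarrow> 1 / real (Suc n) * t"
      by simp
    show "\<exists>N. \<forall>m\<ge>N. \<bar>U n t - U m t\<bar> \<le> (1 / real (Suc n) + inverse (real (Suc m))) * t"
      using diff[OF t] by (auto simp: inverse_eq_divide)
  qed
  have G_bound: "\<bar>G n t x\<bar> \<le> B + 1" for n t x
  proof -
    have "1 / real (Suc n) \<le> 1" by simp
    then show ?thesis using G[of n t x] fbar_bound[of x t] by linarith
  qed
  have V_lip: "\<bar>V t - V s\<bar> \<le> (B + 1) * \<bar>t - s\<bar>" if "0 \<le> s" "0 \<le> t" for s t
  proof (rule LIMSEQ_le_const2)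
    show "(\<lambda>n. \<bar>U n t - U n s\<bar>) \<longlonglongrightarrow> \<bar>V t - V s\<bar>"
      by (intro tendsto_intros V that)
    show "\<exists>N. \<forall>n\<ge>N. \<bar>U n t - U n s\<bar> \<le> (B + 1) * \<bar>t - s\<bar>"
      using ode_sol_lipschitz[OF U G_bound that] by blast
  qed
  have "ode_sol (\<lambda>t x. fbar x t) c V"
    unfolding ode_sol_def
  proof (intro conjI allI impI)
    show "V 0 = c"
      using V[of 0] ode_sol_0[OF U] by (simp add: LIMSEQ_const_iff)
    show "continuous_on {0..} V"
      by (rule lipschitz_on_continuous_on[OF lipschitz_onI, of _ _ "B + 1"])
        (use V_lip B_nonneg in \<open>auto simp: dist_real_def\<close>)
    fix t :: real assume t: "0 < t"
    define S where "S = {0<..<t + 1}"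
    have "\<exists>g. \<forall>x\<in>S. (\<lambda>n. U n x) \<longlonglongrightarrow> g x \<and> (g has_derivative (*) (fbar (V x) x)) (at x within S)"
    proof (rule has_derivative_sequence)
      show "convex S" "t \<in> S" "(\<lambda>n. U n t) \<longlonglongrightarrow> V t"
        using t V by (auto simp: S_def)
      show "(U n has_derivative (*) (G n x (U n x))) (at x within S)" if "x \<in> S" for n x
        using ode_sol_deriv[OF U, of x n] that
        by (auto simp: S_def has_field_derivative_def intro: has_derivative_at_withinI)
      fix e :: real assume "0 < e"
      then have "0 < e / 2" by simp
      \<comment> \<open>One half of \<open>e\<close> pays for replacing \<open>U n\<close> by
        \<open>V\<close> inside \<open>fbar\<close>, the other for replacing \<open>G n\<close> by
        \<open>fbar\<close>.\<close>
      then obtain \<delta> where \<delta>: "0 < \<delta>"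
        "\<And>u1 t1 u2 t2. \<bar>u1 - u2\<bar> + \<bar>t1 - t2\<bar> \<le> \<delta> \<Longrightarrow> \<bar>fbar u1 t1 - fbar u2 t2\<bar> \<le> e / 2"
        using fbar_uniformly_continuous by metis
      have "\<forall>\<^sub>F n in sequentially. inverse (real (Suc n)) < min (e / 2) (\<delta> / (t + 1))"
        using LIMSEQ_inverse_real_of_nat \<open>0 < e\<close> \<delta>(1) t by (intro order_tendstoD(2)) auto
      then show "\<forall>\<^sub>F n in sequentially. \<forall>x\<in>S. \<forall>h.
          norm (G n x (U n x) * h - fbar (V x) x * h) \<le> e * norm h"
      proof eventually_elim
        case (elim n)
        show ?case
        proof (intro ballI allI)
          fix x h assume x: "x \<in> S"
          have "\<bar>U n x - V x\<bar> \<le> 1 / real (Suc n) * x"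
            using VU x by (simp add: S_def)
          also have "\<dots> \<le> 1 / real (Suc n) * (t + 1)"
            using x by (intro mult_left_mono) (auto simp: S_def)
          also have "\<dots> \<le> \<delta>"
            using elim t by (simp add: inverse_eq_divide pos_less_divide_eq)
          finally have "\<bar>fbar (U n x) x - fbar (V x) x\<bar> \<le> e / 2"
            using \<delta>(2)[of "U n x" "V x" x x] by simp
          moreover have "\<bar>G n x (U n x) - fbar (U n x) x\<bar> \<le> e / 2"
            using G[of n x "U n x"] elim by (simp add: inverse_eq_divide)
          ultimately have "\<bar>G n x (U n x) - fbar (V x) x\<bar> \<le> e" by linarith
          then show "norm (G n x (U n x) * h - fbar (V x) x * h) \<le> e * norm h"
            unfolding left_diff_distrib[symmetric] real_norm_def abs_mult by (rule mult_right_mono) simp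
        qed
      qed
    qed
    then obtain g where g: "\<And>x. x \<in> S \<Longrightarrow> (\<lambda>n. U n x) \<longlonglongrightarrow> g x"
      "\<And>x. x \<in> S \<Longrightarrow> (g has_derivative (*) (fbar (V x) x)) (at x within S)"
      by blast
    have gV: "g x = V x" if "x \<in> S" for x
      using LIMSEQ_unique[OF g(1) V] that by (auto simp: S_def)
    have "t \<in> S" "open S"
      using t by (auto simp: S_def)
    then have "(V has_derivative (*) (fbar (V t) t)) (at t within S)"
      using has_derivative_transform[OF _ gV[symmetric] g(2)] by simp
    then show "(V has_real_derivative fbar (V t) t) (at t)"
      by (simp add: has_field_derivative_def at_within_open[OF \<open>t \<in> S\<close> \<open>open S\<close>])
  qed
  then show ?thesis by (rule exI[of _ V])
qed

text \<open>Stability with \<open>H = fbar\<close> and both errors 0: monotonicity plays the part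
  usually taken by a Lipschitz condition.\<close>

lemma averaged_sol_unique:
  assumes "ode_sol (\<lambda>t x. fbar x t) c U" "ode_sol (\<lambda>t x. fbar x t) c V" "0 \<le> t"
  shows "U t = V t"
  using ode_sol_decreasing_stability[OF assms, of "\<lambda>t x. fbar x t" 0 0] fbar_antimono by simp

section \<open>The rate of convergence\<close>

lemma trivial_rate:
  assumes Ue: "ode_sol (\<lambda>t x. f (x / \<epsilon>) (t / \<epsilon>) x t) c Ue"
    and Ub: "ode_sol (\<lambda>t x. fbar x t) c Ub" and t: "0 \<le> t"
  shows "\<bar>Ue t - Ub t\<bar> \<le> 2 * B * t"
proof -
  have "\<bar>Ue t - Ue 0\<bar> \<le> B * t" "\<bar>Ub t - Ub 0\<bar> \<le> B * t"
    using ode_sol_lipschitz[OF Ue bound, of 0 t] ode_sol_lipschitz[OF Ub fbar_bound, of 0 t] t by auto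
  then show ?thesis
    using ode_sol_0[OF Ue] ode_sol_0[OF Ub] by simp
qed

text \<open>Within a piece of length \<open>\<epsilon> * n\<close>, time and \<open>Ub\<close>
  together move by at most \<open>(B + 1) * \<epsilon> * n\<close>. By \<open>small\<close> this
  changes \<open>fbar\<close> by at most \<open>1 / n\<close>, which accumulates to \<epsilon> over
  the piece.\<close>

lemma averaged_increment:
  assumes Ub: "ode_sol (\<lambda>t x. fbar x t) c Ub" and "0 < n" "0 < \<epsilon>" "0 \<le> a" "0 \<le> h" "h \<le> \<epsilon> * real n"
    and small: "\<epsilon> * real n * (B + 1) * exp (\<kappa> * real n) \<le> 1"
  shows "\<bar>Ub (a + h) - Ub a - h * fbar (Ub a) a\<bar> \<le> \<epsilon>"
proof -
  have "\<bar>Ub (a + h) - Ub a - h * fbar (Ub a) a\<bar> \<le> 1 / real n * h"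
  proof (rule ode_sol_increment_bound[OF Ub])
    fix t assume t: "a < t" "t < a + h"
    show "\<bar>fbar (Ub t) t - fbar (Ub a) a\<bar> \<le> 1 / real n"
    proof (rule fbar_diff_le[OF \<open>0 < n\<close>])
      have "\<bar>Ub t - Ub a\<bar> \<le> B * \<bar>t - a\<bar>"
        by (rule ode_sol_lipschitz[OF Ub fbar_bound]) (use assms t in auto)
      then have "\<bar>Ub t - Ub a\<bar> + \<bar>t - a\<bar> \<le> (B + 1) * \<bar>t - a\<bar>"
        by (simp add: algebra_simps)
      also have "\<dots> \<le> (B + 1) * (\<epsilon> * real n)"
        using t assms B_nonneg by (intro mult_left_mono) auto
      finally have "(\<bar>Ub t - Ub a\<bar> + \<bar>t - a\<bar>) * (exp (\<kappa> * real n) - 1)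
          \<le> (B + 1) * (\<epsilon> * real n) * exp (\<kappa> * real n)"
        using \<kappa> B_nonneg \<open>0 < \<epsilon>\<close> by (intro mult_mono) auto
      then show "(\<bar>Ub t - Ub a\<bar> + \<bar>t - a\<bar>) * (exp (\<kappa> * real n) - 1) \<le> 1"
        using small by (simp add: ac_simps)
    qed
  qed (use assms in auto)
  also have "\<dots> \<le> \<epsilon>"
    using assms by (simp add: field_simps)
  finally show ?thesis .
qed

lemma oscillating_increment:
  assumes Ue: "ode_sol (\<lambda>t x. f (x / \<epsilon>) (t / \<epsilon>) x t) c Ue" and n: "0 < n" and \<epsilon>: "0 < \<epsilon>"
    and h: "0 \<le> h" "h \<le> \<epsilon> * real n" and a: "a = \<epsilon> * real N"
    and small: "\<epsilon> * real n * (B + 1) * exp (\<kappa> * real n) \<le> 1"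
  shows "\<bar>Ue (a + h) - Ue a - h * fbar (Ue a) a\<bar> \<le> \<epsilon> * (2 + 2 * B)"
proof -
  define T where "T = h / \<epsilon>"
  define V where "V s = Ue (a + \<epsilon> * s) / \<epsilon>" for s
  have T: "0 \<le> T" "T \<le> real n" "\<epsilon> * T = h"
    using h \<epsilon> by (auto simp: T_def field_simps)
  have a0: "0 \<le> a" using a \<epsilon> by simp
  have V0: "V 0 = Ue a / \<epsilon>" by (simp add: V_def)
  have "\<bar>V T - Y (Ue a) a (V 0) T\<bar> \<le> \<epsilon> * real n * (B + 1) * (exp (\<kappa> * T) - 1)"
  proof (rule Y_compare[OF T(1)])
    have "continuous_on {0..} Ue"
      using Ue by (simp add: ode_sol_def)
    then have "continuous_on {0..T} (\<lambda>s. Ue (a + \<epsilon> * s))"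
      by (rule continuous_on_compose2) (use a0 \<epsilon> in \<open>auto intro!: continuous_intros\<close>)
    then show "continuous_on {0..T} V"
      unfolding V_def[abs_def] using \<epsilon> by (intro continuous_intros) auto
    show "0 \<le> \<epsilon> * real n * (B + 1)"
      using \<epsilon> B_nonneg by simp
    fix s assume s: "0 < s" "s < T"
    let ?t = "a + \<epsilon> * s"
    have t: "0 < ?t" using a0 s \<epsilon> by (simp add: add_nonneg_pos)
    have "(Ue has_real_derivative f (Ue ?t / \<epsilon>) (?t / \<epsilon>) (Ue ?t) ?t) (at ?t)"
      using ode_sol_deriv[OF Ue t] .
    moreover have "?t / \<epsilon> = s + real N"
      using \<epsilon> by (simp add: a field_simps)
    ultimately have "(Ue has_real_derivative f (V s) s (Ue ?t) ?t) (at ?t)"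
      by (simp add: V_def per_\<tau>_nat)
    then have "((\<lambda>s. Ue (a + \<epsilon> * s)) has_real_derivative f (V s) s (Ue ?t) ?t * \<epsilon>) (at s)"
      by (rule DERIV_chain2) (auto intro!: derivative_eq_intros)
    then have "(V has_real_derivative f (V s) s (Ue ?t) ?t * \<epsilon> / \<epsilon>) (at s)"
      unfolding V_def[abs_def] by (rule DERIV_cdivide)
    moreover have "\<bar>Ue ?t - Ue a\<bar> + \<bar>?t - a\<bar> \<le> \<epsilon> * real n * (B + 1)"
    proof -
      have "\<bar>Ue ?t - Ue a\<bar> \<le> B * \<bar>?t - a\<bar>"
        by (rule ode_sol_lipschitz[OF Ue bound]) (use a0 t in auto)
      then have "\<bar>Ue ?t - Ue a\<bar> + \<bar>?t - a\<bar> \<le> (\<epsilon> * s) * (B + 1)"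
        using \<epsilon> s by (simp add: algebra_simps)
      also have "\<dots> \<le> (\<epsilon> * real n) * (B + 1)"
        using s T \<epsilon> B_nonneg by (intro mult_right_mono mult_left_mono) auto
      finally show ?thesis .
    qed
    ultimately show "\<exists>p q. (V has_real_derivative f (V s) s p q) (at s) \<and>
        \<bar>p - Ue a\<bar> + \<bar>q - a\<bar> \<le> \<epsilon> * real n * (B + 1)"
      using \<epsilon> by fastforce
  qed
  also have "\<dots> \<le> \<epsilon> * real n * (B + 1) * exp (\<kappa> * real n)"
  proof (rule mult_left_mono)
    have "exp (\<kappa> * T) \<le> exp (\<kappa> * real n)" using T \<kappa> by simp
    then show "exp (\<kappa> * T) - 1 \<le> exp (\<kappa> * real n)" by linarith
  qed (use \<epsilon> B_nonneg in auto)
  finally have V: "\<bar>V T - Y (Ue a) a (V 0) T\<bar> \<le> 1"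
    using small by linarith
  \<comment> \<open>\<open>Y_deviation\<close> speaks of integer times only, so \<open>T\<close> is
    rounded down.\<close>
  define j where "j = nat \<lfloor>T\<rfloor>"
  have j: "real j \<le> T" "T - real j \<le> 1"
    using T unfolding j_def by linarith+
  have "\<bar>Y (Ue a) a (V 0) T - Y (Ue a) a (V 0) (real j)\<bar> \<le> B * \<bar>T - real j\<bar>"
    by (rule ode_sol_lipschitz[OF Y_sol bound]) (use T in auto)
  also have "\<dots> \<le> B * 1"
    using j B_nonneg by (intro mult_left_mono) auto
  finally have Yj: "\<bar>Y (Ue a) a (V 0) T - Y (Ue a) a (V 0) (real j)\<bar> \<le> B" by simp
  have "\<bar>(T - real j) * fbar (Ue a) a\<bar> \<le> 1 * B"
    unfolding abs_mult using j fbar_bound by (intro mult_mono) auto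
  then have "\<bar>V T - V 0 - T * fbar (Ue a) a\<bar> \<le> 2 + 2 * B"
    using V Yj Y_deviation[of "Ue a" a "V 0" j] by (simp add: left_diff_distrib)
  then have "\<epsilon> * \<bar>V T - V 0 - T * fbar (Ue a) a\<bar> \<le> \<epsilon> * (2 + 2 * B)"
    using \<epsilon> by (intro mult_left_mono) auto
  moreover have "Ue (a + h) - Ue a - h * fbar (Ue a) a = \<epsilon> * (V T - V 0 - T * fbar (Ue a) a)"
    using \<epsilon> T by (simp add: V_def algebra_simps)
  ultimately show ?thesis
    using \<epsilon> by (simp add: abs_mult)
qed

text \<open>If \<open>A\<close> lies above \<open>C\<close>, monotonicity bounds \<open>A' - C'\<close>; if it lies far below, one step cannot
  close the gap; in between, \<open>fbar\<close> differs little.\<close>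

lemma increment_stability:
  assumes h: "0 \<le> h" "h \<le> \<epsilon> * real n" and n: "0 < n" and \<epsilon>: "0 < \<epsilon>"
    and A: "\<bar>A' - A - h * fbar A a\<bar> \<le> \<eta>" and C: "\<bar>C' - C - h * fbar C a\<bar> \<le> \<eta>"
    and small: "\<epsilon> * real n * (2 * B + 1) * exp (\<kappa> * real n) \<le> 1"
  shows "\<bar>A' - C'\<bar> \<le> \<bar>A - C\<bar> + 2 * \<eta> + \<epsilon>"
proof -
  have *: "A' - C' \<le> \<bar>A - C\<bar> + 2 * \<eta> + \<epsilon>"
    if A: "\<bar>A' - A - h * fbar A a\<bar> \<le> \<eta>" and C: "\<bar>C' - C - h * fbar C a\<bar> \<le> \<eta>" for A A' C C'
  proof (cases "C \<le> A")
    case True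
    then have "h * fbar A a \<le> h * fbar C a"
      using h fbar_antimono by (intro mult_left_mono) auto
    then show ?thesis using A C True \<epsilon> by linarith
  next
    case False
    show ?thesis
    \<comment> \<open>Since \<open>fbar\<close> is bounded by \<open>B\<close>, one step changes the
      gap by at most \<open>2 * B * h\<close> up to the errors \<eta>. A gap below this threshold is
      covered by the factor \<open>2 * B + 1\<close> in \<open>small\<close>.\<close>
    proof (cases "C - A \<le> 2 * B * h")
      case True
      have "\<bar>fbar A a - fbar C a\<bar> \<le> 1 / real n"
      proof (rule fbar_diff_le[OF n])
        have "\<bar>A - C\<bar> + \<bar>a - a\<bar> \<le> 2 * B * h"
          using False True by simp
        also have "\<dots> \<le> 2 * B * (\<epsilon> * real n)"
          using h B_nonneg by (intro mult_left_mono) auto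
        also have "\<dots> \<le> \<epsilon> * real n * (2 * B + 1)"
          using \<epsilon> by (simp add: algebra_simps)
        finally have "(\<bar>A - C\<bar> + \<bar>a - a\<bar>) * (exp (\<kappa> * real n) - 1)
            \<le> \<epsilon> * real n * (2 * B + 1) * exp (\<kappa> * real n)"
          using \<kappa> B_nonneg \<epsilon> by (intro mult_mono) auto
        then show "(\<bar>A - C\<bar> + \<bar>a - a\<bar>) * (exp (\<kappa> * real n) - 1) \<le> 1"
          using small by linarith
      qed
      then have "h * (fbar A a - fbar C a) \<le> (\<epsilon> * real n) * (1 / real n)"
        using h fbar_antimono[of A C a] False n \<epsilon> by (intro mult_mono) simp_all
      also have "\<dots> = \<epsilon>" using n by simp
      finally have "h * fbar A a - h * fbar C a \<le> \<epsilon>" by (simp add: algebra_simps)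
      then show ?thesis using A C False by linarith
    next
      case False': False
      have "h * (fbar A a - fbar C a) \<le> h * (2 * B)"
        using h fbar_bound[of A a] fbar_bound[of C a] by (intro mult_left_mono) auto
      then have "h * fbar A a - h * fbar C a \<le> 2 * B * h" by (simp add: algebra_simps)
      then show ?thesis using A C False' \<epsilon> by linarith
    qed
  qed
  show ?thesis
    using *[OF A C] *[OF C A] by (simp add: abs_le_iff abs_minus_commute)
qed

section \<open>Summing the pieces and choosing their length\<close>

text \<open>All pieces start at integer multiples of \<epsilon>. Each adds at most \<open>K\<close>,
  made of two increment errors \<open>\<epsilon> * (2 + 2 * B)\<close> and one further \<epsilon>;
  there are at most \<open>t / (\<epsilon> * n)\<close> full pieces and one remainder.\<close>

lemma rate_at_scale:
  assumes Ue: "ode_sol (\<lambda>t x. f (x / \<epsilon>) (t / \<epsilon>) x t) c Ue"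
    and Ub: "ode_sol (\<lambda>t x. fbar x t) c Ub" and n: "0 < n" and \<epsilon>: "0 < \<epsilon>" and t: "0 \<le> t"
    and small: "\<epsilon> * real n * (2 * B + 1) * exp (\<kappa> * real n) \<le> 1"
  shows "\<bar>Ue t - Ub t\<bar> \<le> (5 + 4 * B) * (t / real n + \<epsilon>)"
proof -
  have "\<epsilon> * real n * (B + 1) * exp (\<kappa> * real n) \<le> \<epsilon> * real n * (2 * B + 1) * exp (\<kappa> * real n)"
    using \<epsilon> B_nonneg by (intro mult_right_mono mult_left_mono) auto
  then have small': "\<epsilon> * real n * (B + 1) * exp (\<kappa> * real n) \<le> 1"
    using small by linarith
  define K where "K = \<epsilon> * (5 + 4 * B)"
  have step: "\<bar>Ue (a + h) - Ub (a + h)\<bar> \<le> \<bar>Ue a - Ub a\<bar> + K"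
    if "a = \<epsilon> * real N" "0 \<le> h" "h \<le> \<epsilon> * real n" for a N h
  proof -
    have a: "0 \<le> a" using that \<epsilon> by simp
    have "\<bar>Ub (a + h) - Ub a - h * fbar (Ub a) a\<bar> \<le> \<epsilon> * 1"
      using averaged_increment[OF Ub n \<epsilon> a that(2,3) small'] by simp
    also have "\<dots> \<le> \<epsilon> * (2 + 2 * B)"
      using \<epsilon> B_nonneg by (intro mult_left_mono) auto
    finally have "\<bar>Ub (a + h) - Ub a - h * fbar (Ub a) a\<bar> \<le> \<epsilon> * (2 + 2 * B)" .
    then have "\<bar>Ue (a + h) - Ub (a + h)\<bar> \<le> \<bar>Ue a - Ub a\<bar> + 2 * (\<epsilon> * (2 + 2 * B)) + \<epsilon>"
      by (rule increment_stability[OF that(2,3) n \<epsilon> oscillating_increment[OF Ue n \<epsilon> that(2,3,1) small'] _ small])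
    then show ?thesis by (simp add: K_def algebra_simps)
  qed
  have nodes: "\<bar>Ue (\<epsilon> * real (k * n)) - Ub (\<epsilon> * real (k * n))\<bar> \<le> real k * K" for k
  proof (induction k)
    case 0
    then show ?case using ode_sol_0[OF Ue] ode_sol_0[OF Ub] by simp
  next
    case (Suc k)
    have "\<epsilon> * real (Suc k * n) = \<epsilon> * real (k * n) + \<epsilon> * real n"
      by (simp add: algebra_simps)
    then show ?case
      using step[of "\<epsilon> * real (k * n)" "k * n" "\<epsilon> * real n"] Suc \<epsilon> by (simp add: algebra_simps)
  qed
  define d where "d = \<epsilon> * real n"
  have d: "0 < d" using \<epsilon> n by (simp add: d_def)
  define k where "k = nat \<lfloor>t / d\<rfloor>"
  have "0 \<le> t / d" using t d by simp
  then have "real k \<le> t / d" "t / d \<le> real k + 1"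
    unfolding k_def by linarith+
  then have k: "real k * d \<le> t" "t \<le> real k * d + d"
    using d by (auto simp: field_simps)
  define h where "h = t - \<epsilon> * real (k * n)"
  have kd: "\<epsilon> * real (k * n) = real k * d" by (simp add: d_def)
  have "\<bar>Ue t - Ub t\<bar> \<le> \<bar>Ue (\<epsilon> * real (k * n)) - Ub (\<epsilon> * real (k * n))\<bar> + K"
    using step[of "\<epsilon> * real (k * n)" "k * n" h] k unfolding h_def kd by (simp add: d_def)
  also have "\<dots> \<le> real k * K + K"
    using nodes[of k] by simp
  also have "\<dots> \<le> (t / d) * K + K"
    using \<open>real k \<le> t / d\<close> \<epsilon> B_nonneg by (intro add_right_mono mult_right_mono) (auto simp: K_def)
  also have "\<dots> = (5 + 4 * B) * (t / real n + \<epsilon>)"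
    using \<epsilon> n by (simp add: K_def d_def field_simps)
  finally show ?thesis .
qed

text \<open>The scale \<open>n\<close> is about \<open>\<bar>ln \<epsilon>\<bar> / a\<close>, where
  \<open>a\<close> is chosen so that \<epsilon> absorbs both \<open>exp (\<kappa> * n)\<close> and
  the polynomial factor in \<open>small\<close>. If \<epsilon> is too close to 1 for such an
  \<open>n\<close>, the trivial bound suffices.\<close>

lemma rate:
  assumes Ue: "ode_sol (\<lambda>t x. f (x / \<epsilon>) (t / \<epsilon>) x t) c Ue"
    and Ub: "ode_sol (\<lambda>t x. fbar x t) c Ub" and \<epsilon>: "0 < \<epsilon>" "\<epsilon> < 1" and t: "0 \<le> t"
  defines "a \<equiv> \<kappa> + 2 * B + 1"
  shows "\<epsilon> * \<bar>ln \<epsilon>\<bar> < t \<Longrightarrow> \<bar>Ue t - Ub t\<bar> \<le> 4 * (5 + 4 * B) * a * t / \<bar>ln \<epsilon>\<bar>"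
    and "t \<le> \<epsilon> * \<bar>ln \<epsilon>\<bar> \<Longrightarrow> \<bar>Ue t - Ub t\<bar> \<le> 4 * (5 + 4 * B) * a * \<epsilon>"
proof -
  define l where "l = \<bar>ln \<epsilon>\<bar>"
  have l: "l = - ln \<epsilon>" "0 < l" "\<epsilon> = exp (- l)"
    using \<epsilon> by (auto simp: l_def)
  have a: "1 \<le> a" using \<kappa> B_nonneg by (simp add: a_def)
  \<comment> \<open>The maximum equals \<open>t / l\<close> beyond time
    \<open>\<epsilon> * l\<close> and \<epsilon> before it, so both regimes follow from one
    estimate. The factor \<open>2 * a\<close> comes from \<open>n\<close> being at least
    \<open>l / (2 * a)\<close>, the last 2 from bounding a sum of two terms by their
    maximum.\<close>
  have main: "\<bar>Ue t - Ub t\<bar> \<le> (5 + 4 * B) * (2 * a) * max (t / l) \<epsilon> * 2"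
  proof (cases "a \<le> l")
    case True
    define n where "n = nat \<lfloor>l / a\<rfloor>"
    have la: "1 \<le> l / a" using True a by simp
    then have n_floor: "real n = of_int \<lfloor>l / a\<rfloor>" by (simp add: n_def)
    have "0 < n" using la by (simp add: n_def)
    have "real n \<le> l / a" "l / a < real n + 1"
      unfolding n_floor by linarith+
    with \<open>0 < n\<close> have n: "0 < n" "real n \<le> l / a" "l / a \<le> 2 * real n"
      by linarith+
    then have an: "a * real n \<le> l" "l \<le> 2 * a * real n"
      using a by (auto simp: field_simps)
    \<comment> \<open>Because \<open>a * n = \<kappa> * n + x + n\<close> is at most
      \<open>l\<close>, the exponent \<open>\<kappa> * n - l\<close> is at most \<open>- x\<close>,
      and \<open>x * exp (- x)\<close> is at most 1.\<close>
    define x where "x = real n * (2 * B + 1)"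
    have "\<epsilon> * real n * (2 * B + 1) * exp (\<kappa> * real n) = x * exp (\<kappa> * real n - l)"
      by (simp add: l(3) x_def exp_diff exp_minus field_simps)
    also have "\<dots> \<le> x * exp (- x)"
      using an B_nonneg by (intro mult_left_mono) (auto simp: x_def a_def algebra_simps)
    also have "\<dots> \<le> 1"
    proof -
      have "x \<le> exp x" using exp_ge_add_one_self[of x] by linarith
      then show ?thesis by (simp add: exp_minus field_simps)
    qed
    finally have "\<bar>Ue t - Ub t\<bar> \<le> (5 + 4 * B) * (t / real n + \<epsilon>)"
      by (rule rate_at_scale[OF Ue Ub n(1) \<epsilon>(1) t])
    also have "\<dots> \<le> (5 + 4 * B) * (2 * a * (t / l) + 2 * a * \<epsilon>)"
    proof (intro mult_left_mono add_mono)
      have "t * l \<le> t * (2 * a * real n)"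
        using an t by (intro mult_left_mono) auto
      then show "t / real n \<le> 2 * a * (t / l)"
        using n l(2) by (simp add: field_simps)
      show "\<epsilon> \<le> 2 * a * \<epsilon>" using a \<epsilon> by simp
    qed (use B_nonneg in auto)
    also have "\<dots> \<le> (5 + 4 * B) * (2 * a * max (t / l) \<epsilon> + 2 * a * max (t / l) \<epsilon>)"
      using a B_nonneg by (intro mult_left_mono add_mono) auto
    finally show ?thesis by (simp add: algebra_simps)
  next
    case False
    have tl: "0 \<le> t / l" using t l(2) by simp
    have "\<bar>Ue t - Ub t\<bar> \<le> 2 * B * t"
      by (rule trivial_rate[OF Ue Ub t])
    also have "\<dots> = 2 * B * (l * (t / l))"
      using l(2) by simp
    also have "\<dots> \<le> 2 * B * (a * max (t / l) \<epsilon>)"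
      using False tl l(2) a B_nonneg by (intro mult_left_mono mult_mono) auto
    also have "\<dots> \<le> (4 * (5 + 4 * B)) * (a * max (t / l) \<epsilon>)"
      using a B_nonneg \<epsilon> by (intro mult_right_mono) (auto simp: le_max_iff_disj)
    finally show ?thesis by (simp add: algebra_simps)
  qed
  {
    assume "\<epsilon> * \<bar>ln \<epsilon>\<bar> < t"
    then have "max (t / l) \<epsilon> = t / l"
      using l(2) by (simp add: l_def[symmetric] field_simps)
    then show "\<bar>Ue t - Ub t\<bar> \<le> 4 * (5 + 4 * B) * a * t / \<bar>ln \<epsilon>\<bar>"
      using main by (simp add: l_def ac_simps)
  next
    assume "t \<le> \<epsilon> * \<bar>ln \<epsilon>\<bar>"
    then have "max (t / l) \<epsilon> = \<epsilon>"
      using l(2) by (simp add: l_def[symmetric] field_simps)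
    then show "\<bar>Ue t - Ub t\<bar> \<le> 4 * (5 + 4 * B) * a * \<epsilon>"
      using main by (simp add: ac_simps)
  }
qed

end

section \<open>The Lambert modulus and the Sobolev norm\<close>

lemma lambertW_eqI:
  assumes "0 \<le> x" "x * exp x = y"
  shows "lambertW y = x"
  unfolding lambertW_def
proof (rule the_equality)
  fix z assume z: "0 \<le> z \<and> z * exp z = y"
  show "z = x"
  proof (cases z x rule: linorder_cases)
    case less
    then have "z * exp z < x * exp x" using z by (intro mult_strict_mono) auto
    then show ?thesis using z assms by simp
  next
    case greater
    then have "x * exp x < z * exp z" using assms by (intro mult_strict_mono) auto
    then show ?thesis using z assms by simp
  qed
qed (use assms in simp)

lemma lambertW_props:
  assumes "0 \<le> y"
  shows "0 \<le> lambertW y" "lambertW y * exp (lambertW y) = y"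
proof -
  have "\<exists>x\<ge>0. x \<le> y \<and> x * exp x = y"
  proof (rule IVT')
    show "0 * exp 0 \<le> y" using assms by simp
    have "y * 1 \<le> y * exp y" using assms by (intro mult_left_mono) auto
    then show "y \<le> y * exp y" by simp
  qed (use assms in \<open>auto intro!: continuous_intros\<close>)
  then obtain x where "0 \<le> x" "x * exp x = y" by blast
  then show "0 \<le> lambertW y" "lambertW y * exp (lambertW y) = y"
    using lambertW_eqI by simp_all
qed

text \<open>With \<open>w = W(1 / \<delta>)\<close>, the inequality
  \<open>exp w - 1 \<le> w * exp w\<close> gives \<open>\<delta> * (exp w - 1) \<le> 1\<close>, and
  \<open>\<kappa> * k \<le> w\<close>, so \<open>n = k\<close> is admissible in
  \<open>fbar_diff_le\<close>.\<close>

lemma (in averaging) fbar_modulus: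
  fixes k :: int
  assumes k: "k = \<lfloor>(1 / \<kappa>) * lambertW (1 / (\<bar>u1 - u2\<bar> + \<bar>t1 - t2\<bar>))\<rfloor>" "0 < k"
  shows "\<bar>fbar u1 t1 - fbar u2 t2\<bar> \<le> 1 / real_of_int k"
proof -
  define \<delta> where "\<delta> = \<bar>u1 - u2\<bar> + \<bar>t1 - t2\<bar>"
  define w where "w = lambertW (1 / \<delta>)"
  have w: "0 \<le> w" "w * exp w = 1 / \<delta>"
    using lambertW_props[of "1 / \<delta>"] by (auto simp: w_def \<delta>_def)
  have kw: "real_of_int k \<le> w / \<kappa>"
    using k(1) by (simp add: w_def \<delta>_def)
  \<comment> \<open>This also rules out \<delta> = 0: there \<open>1 / \<delta>\<close> is 0 by
    convention, so \<open>w\<close> would be 0 and \<open>k\<close> not positive.\<close>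
  have "w \<noteq> 0" using kw k(2) by auto
  then have "0 < w" using w by simp
  then have "1 / \<delta> > 0" unfolding w(2)[symmetric] by simp
  then have \<delta>: "0 < \<delta>" by simp
  define n where "n = nat k"
  have n: "0 < n" "real n = real_of_int k"
    using k(2) by (auto simp: n_def)
  have "\<kappa> * real n \<le> w"
    using kw \<kappa> n by (simp add: field_simps)
  then have "\<delta> * (exp (\<kappa> * real n) - 1) \<le> \<delta> * (exp w - 1)"
    using \<delta> by (intro mult_left_mono) auto
  also have "\<dots> \<le> \<delta> * (w * exp w)"
  proof (rule mult_left_mono)
    have "(1 - w) * exp w \<le> exp (- w) * exp w"
      using exp_ge_add_one_self[of "- w"] by (intro mult_right_mono) auto
    also have "\<dots> = 1" by (simp flip: exp_add)
    finally show "exp w - 1 \<le> w * exp w" by (simp add: algebra_simps)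
  qed (use \<delta> in simp)
  also have "\<dots> = 1" using w \<delta> by simp
  finally show ?thesis
    using fbar_diff_le[OF n(1), of u1 u2 t1 t2] n(2) by (simp add: \<delta>_def)
qed

section \<open>Constants controlled by the Sobolev norm\<close>

lemma bdd_above_uncurry4:
  assumes "bounded (range (uncurry4 f))"
  shows "bdd_above (range (\<lambda>x. \<bar>uncurry4 f x\<bar>))"
proof -
  obtain b where "\<And>x. norm (uncurry4 f x) \<le> b"
    using assms by (auto simp: bounded_iff)
  then show ?thesis by (auto intro!: bdd_aboveI)
qed

lemma abs_le_sup_norm:
  assumes "bounded (range (uncurry4 f))"
  shows "\<bar>f r \<tau> u t\<bar> \<le> sup_norm f"
  using cSUP_upper[OF UNIV_I bdd_above_uncurry4[OF assms], of "(r, \<tau>, u, t)"]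
  by (simp add: sup_norm_def uncurry4_def)

lemma dist_quadruple_le:
  fixes r \<tau> u t r' \<tau>' u' t' :: real
  shows "dist (r, \<tau>, u, t) (r', \<tau>', u', t') \<le> \<bar>r - r'\<bar> + \<bar>\<tau> - \<tau>'\<bar> + \<bar>u - u'\<bar> + \<bar>t - t'\<bar>"
proof -
  have pair: "dist (a, b) (a', b') \<le> dist a a' + dist b b'"
    for a a' :: "'x::metric_space" and b b' :: "'y::metric_space"
    by (simp add: dist_Pair_Pair sqrt_sum_squares_le_sum)
  show ?thesis
    using pair[of r "(\<tau>, u, t)" r' "(\<tau>', u', t')"] pair[of \<tau> "(u, t)" \<tau>' "(u', t')"] pair[of u t u' t']
    by (simp add: dist_real_def)
qed

lemma lipschitz_uncurry4D:
  assumes "\<kappa>-lipschitz_on UNIV (uncurry4 f)"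
  shows "\<bar>f r \<tau> u t - f r' \<tau>' u' t'\<bar> \<le> \<kappa> * (\<bar>r - r'\<bar> + \<bar>\<tau> - \<tau>'\<bar> + \<bar>u - u'\<bar> + \<bar>t - t'\<bar>)"
proof -
  have "\<bar>f r \<tau> u t - f r' \<tau>' u' t'\<bar> \<le> \<kappa> * dist (r, \<tau>, u, t) (r', \<tau>', u', t')"
    using lipschitz_onD[OF assms, of "(r, \<tau>, u, t)" "(r', \<tau>', u', t')"]
    by (simp add: uncurry4_def dist_real_def)
  also have "\<dots> \<le> \<kappa> * (\<bar>r - r'\<bar> + \<bar>\<tau> - \<tau>'\<bar> + \<bar>u - u'\<bar> + \<bar>t - t'\<bar>)"
    using lipschitz_on_nonneg[OF assms] by (intro mult_left_mono dist_quadruple_le)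
  finally show ?thesis .
qed

text \<open>The \<kappa>-Lipschitz bound makes the difference quotients bounded above, so their
  \<open>SUP\<close> is a genuine supremum and hence a Lipschitz constant. Boundedness of
  \<open>f\<close> does the same for \<open>sup_norm\<close>; each of the two summands is
  nonnegative.\<close>

lemma w1inf_norm_bounds:
  assumes bdd: "bounded (range (uncurry4 f))" and lip: "\<kappa>-lipschitz_on UNIV (uncurry4 f)"
  shows "sup_norm f \<le> w1inf_norm f" and "(w1inf_norm f)-lipschitz_on UNIV (uncurry4 f)"
proof -
  define q where "q p = dist (uncurry4 f (fst p)) (uncurry4 f (snd p)) / dist (fst p) (snd p)" for p
  define P where "P = {(x, y). x \<noteq> (y :: real \<times> real \<times> real \<times> real)}"
  have w1: "w1inf_norm f = sup_norm f + (SUP p\<in>P. q p)"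
    by (simp add: w1inf_norm_def P_def q_def)
  have "q p \<le> \<kappa>" if "p \<in> P" for p
  proof -
    have "0 < dist (fst p) (snd p)"
      using that by (simp add: P_def case_prod_unfold)
    then show ?thesis
      using lipschitz_onD[OF lip, of "fst p" "snd p"] by (simp add: q_def pos_divide_le_eq)
  qed
  then have "bdd_above (q ` P)"
    by (rule bdd_aboveI2)
  then have q: "q p \<le> (SUP p\<in>P. q p)" if "p \<in> P" for p
    using that by (intro cSUP_upper)
  have "((0, 0, 0, 0), (1, 0, 0, 0)) \<in> P" by (simp add: P_def)
  then have "0 \<le> (SUP p\<in>P. q p)"
    using q[of "((0, 0, 0, 0), (1, 0, 0, 0))"] by (smt (verit) q_def divide_nonneg_nonneg zero_le_dist)
  then show le: "sup_norm f \<le> w1inf_norm f"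
    by (simp add: w1)
  have s: "0 \<le> sup_norm f"
    using abs_le_sup_norm[OF bdd, of 0 0 0 0] by linarith
  show "(w1inf_norm f)-lipschitz_on UNIV (uncurry4 f)"
  proof (rule lipschitz_onI)
    fix x y :: "real \<times> real \<times> real \<times> real"
    show "dist (uncurry4 f x) (uncurry4 f y) \<le> w1inf_norm f * dist x y"
    proof (cases "x = y")
      case False
      then have "q (x, y) \<le> w1inf_norm f"
        using q[of "(x, y)"] s by (simp add: w1 P_def)
      then show ?thesis
        using False by (simp add: q_def pos_divide_le_eq)
    qed simp
  qed (use le s in simp)
qed

section \<open>Assembly with a uniform constant\<close>

theorem theorem1p2:
  shows "\<exists>\<Phi> :: real \<Rightarrow> real. (\<forall>M. 0 < \<Phi> M) \<and>
   (\<forall>(f :: real \<Rightarrow> real \<Rightarrow> real \<Rightarrow> real \<Rightarrow> real) (\<kappa> :: real) (fbar :: real \<Rightarrow> real \<Rightarrow> real).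
     ( 0 < \<kappa>
     \<and> bounded (range (uncurry4 f))
     \<and> \<kappa>-lipschitz_on UNIV (uncurry4 f)
     \<and> (\<forall>r \<tau> u t. f (r + 1) \<tau> u t = f r \<tau> u t)
     \<and> (\<forall>r \<tau> u t. f r (\<tau> + 1) u t = f r \<tau> u t)
     \<and> (\<forall>r \<tau> u u' t. u \<le> u' \<longrightarrow> f r \<tau> u' t \<le> f r \<tau> u t)
     \<and> (\<forall>u0 t0 c t. t > 0 \<longrightarrow>
          (\<forall>U :: real \<Rightarrow> real \<Rightarrow> real.
             (\<forall>\<epsilon>>0. ode_sol (\<lambda>s x. f (x / \<epsilon>) (s / \<epsilon>) u0 t0) c (U \<epsilon>)) \<longrightarrow>
             ((\<lambda>\<epsilon>. U \<epsilon> t) \<longlongrightarrow> c + fbar u0 t0 * t) (at_right 0))))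
     \<longrightarrow>
     \<comment> \<open>(i)\<close>
     (\<forall>t1 t2 u1 u2 :: real. t1 > 0 \<longrightarrow> t2 > 0 \<longrightarrow>
        (let k = \<lfloor>(1 / \<kappa>) * lambertW (1 / (\<bar>u1 - u2\<bar> + \<bar>t1 - t2\<bar>))\<rfloor> in
          0 < k \<longrightarrow> \<bar>fbar u1 t1 - fbar u2 t2\<bar> \<le> 2 / real_of_int k))
     \<and>
     \<comment> \<open>(ii)\<close>
     (\<forall>c. \<exists>Ub. ode_sol (\<lambda>t x. fbar x t) c Ub \<and>
              (\<forall>V. ode_sol (\<lambda>t x. fbar x t) c V \<longrightarrow> (\<forall>t\<ge>0. V t = Ub t)))
     \<and>
     \<comment> \<open>(iii)\<close>
     (\<forall>\<epsilon> c Ue Ub. 0 < \<epsilon> \<longrightarrow> \<epsilon> < 1 \<longrightarrow>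
        ode_sol (\<lambda>t x. f (x / \<epsilon>) (t / \<epsilon>) x t) c Ue \<longrightarrow>
        ode_sol (\<lambda>t x. fbar x t) c Ub \<longrightarrow>
        (\<forall>t. t > \<epsilon> * \<bar>ln \<epsilon>\<bar> \<longrightarrow>
           \<bar>Ue t - Ub t\<bar> \<le> \<Phi> (w1inf_norm f) * t / \<bar>ln \<epsilon>\<bar>) \<and>
        (\<forall>t. 0 \<le> t \<longrightarrow> t \<le> \<epsilon> * \<bar>ln \<epsilon>\<bar> \<longrightarrow>
           \<bar>Ue t - Ub t\<bar> \<le> min (\<Phi> (w1inf_norm f) * \<epsilon>) (2 * sup_norm f * t))))"
proof -
  \<comment> \<open>\<Phi> is the constant of \<open>rate\<close> with both \<kappa> and
    \<open>B\<close> replaced by \<open>L M\<close>. Adding 1 keeps this positive even when the norm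
    is 0, as for \<open>f = 0\<close>.\<close>
  define L where "L M = \<bar>M\<bar> + 1" for M :: real
  define \<Phi> where "\<Phi> M = 4 * (5 + 4 * L M) * (L M + 2 * L M + 1)" for M
  have L: "0 < L M" for M by (simp add: L_def)
  have \<Phi>: "0 < \<Phi> M" for M
    unfolding \<Phi>_def using L[of M] by (intro mult_pos_pos) auto
  show ?thesis
  proof (rule exI[of _ \<Phi>], rule conjI, use \<Phi> in blast, rule allI, rule allI, rule allI, rule impI, goal_cases)
    case (1 f \<kappa> fbar)
    then have f_bdd: "bounded (range (uncurry4 f))" and f_lip: "\<kappa>-lipschitz_on UNIV (uncurry4 f)"
      by simp_all
    interpret averaging f \<kappa> "sup_norm f" fbar
    proof
      show "\<bar>f r \<tau> u t\<bar> \<le> sup_norm f" for r \<tau> u t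
        using f_bdd by (rule abs_le_sup_norm)
      show "\<bar>f r \<tau> u t - f r' \<tau>' u' t'\<bar> \<le> \<kappa> * (\<bar>r - r'\<bar> + \<bar>\<tau> - \<tau>'\<bar> + \<bar>u - u'\<bar> + \<bar>t - t'\<bar>)"
        for r \<tau> u t r' \<tau>' u' t'
        using f_lip by (rule lipschitz_uncurry4D)
    qed (use 1 in simp_all)
    define K where "K = L (w1inf_norm f)"
    have K: "sup_norm f \<le> K" "w1inf_norm f \<le> K"
      using w1inf_norm_bounds(1)[OF f_bdd f_lip] by (auto simp: K_def L_def)
    \<comment> \<open>The first interpretation keeps \<kappa> for (i) and \<open>sup_norm f\<close>
      for the bound linear in \<open>t\<close>; this second one makes the constant in (iii) a
      function of the norm alone.\<close>
    interpret K: averaging f K K fbar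
    proof
      show "0 < K" unfolding K_def by (rule L)
      show "\<bar>f r \<tau> u t\<bar> \<le> K" for r \<tau> u t
        using bound K(1) by (rule order_trans)
      show "\<bar>f r \<tau> u t - f r' \<tau>' u' t'\<bar> \<le> K * (\<bar>r - r'\<bar> + \<bar>\<tau> - \<tau>'\<bar> + \<bar>u - u'\<bar> + \<bar>t - t'\<bar>)"
        for r \<tau> u t r' \<tau>' u' t'
        by (rule lipschitz_uncurry4D[OF lipschitz_on_le[OF w1inf_norm_bounds(2)[OF f_bdd f_lip] K(2)]])
    qed (fact per_r per_\<tau> antimono average)+
    have \<Phi>_K: "\<Phi> (w1inf_norm f) = 4 * (5 + 4 * K) * (K + 2 * K + 1)"
      by (simp add: \<Phi>_def K_def)
    show ?case
    proof (intro conjI)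
      show "\<forall>t1 t2 u1 u2. 0 < t1 \<longrightarrow> 0 < t2 \<longrightarrow>
        (let k = \<lfloor>(1 / \<kappa>) * lambertW (1 / (\<bar>u1 - u2\<bar> + \<bar>t1 - t2\<bar>))\<rfloor> in
          0 < k \<longrightarrow> \<bar>fbar u1 t1 - fbar u2 t2\<bar> \<le> 2 / real_of_int k)"
      proof (unfold Let_def, intro allI impI)
        fix t1 t2 u1 u2 :: real
        define k where "k = \<lfloor>1 / \<kappa> * lambertW (1 / (\<bar>u1 - u2\<bar> + \<bar>t1 - t2\<bar>))\<rfloor>"
        assume "0 < \<lfloor>1 / \<kappa> * lambertW (1 / (\<bar>u1 - u2\<bar> + \<bar>t1 - t2\<bar>))\<rfloor>"
        then have k: "0 < k" by (simp add: k_def)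
        have "\<bar>fbar u1 t1 - fbar u2 t2\<bar> \<le> 1 / real_of_int k"
          using k_def k by (rule fbar_modulus)
        also have "\<dots> \<le> 2 / real_of_int k"
          using k by (intro divide_right_mono) auto
        finally show "\<bar>fbar u1 t1 - fbar u2 t2\<bar>
            \<le> 2 / real_of_int \<lfloor>1 / \<kappa> * lambertW (1 / (\<bar>u1 - u2\<bar> + \<bar>t1 - t2\<bar>))\<rfloor>"
          by (simp add: k_def)
      qed
      show "\<forall>c. \<exists>Ub. ode_sol (\<lambda>t x. fbar x t) c Ub \<and>
          (\<forall>V. ode_sol (\<lambda>t x. fbar x t) c V \<longrightarrow> (\<forall>t\<ge>0. V t = Ub t))"
      proof
        fix c
        obtain Ub where "ode_sol (\<lambda>t x. fbar x t) c Ub"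
          using averaged_sol_exists by blast
        then show "\<exists>Ub. ode_sol (\<lambda>t x. fbar x t) c Ub \<and>
            (\<forall>V. ode_sol (\<lambda>t x. fbar x t) c V \<longrightarrow> (\<forall>t\<ge>0. V t = Ub t))"
          by (intro exI[of _ Ub]) (auto intro: averaged_sol_unique)
      qed
    next
      show "\<forall>\<epsilon> c Ue Ub. 0 < \<epsilon> \<longrightarrow> \<epsilon> < 1 \<longrightarrow>
        ode_sol (\<lambda>t x. f (x / \<epsilon>) (t / \<epsilon>) x t) c Ue \<longrightarrow>
        ode_sol (\<lambda>t x. fbar x t) c Ub \<longrightarrow>
        (\<forall>t. t > \<epsilon> * \<bar>ln \<epsilon>\<bar> \<longrightarrow>
           \<bar>Ue t - Ub t\<bar> \<le> \<Phi> (w1inf_norm f) * t / \<bar>ln \<epsilon>\<bar>) \<and>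
        (\<forall>t. 0 \<le> t \<longrightarrow> t \<le> \<epsilon> * \<bar>ln \<epsilon>\<bar> \<longrightarrow>
           \<bar>Ue t - Ub t\<bar> \<le> min (\<Phi> (w1inf_norm f) * \<epsilon>) (2 * sup_norm f * t))"
      proof (intro allI impI conjI)
        fix \<epsilon> c Ue Ub and t :: real
        assume \<epsilon>: "0 < \<epsilon>" "\<epsilon> < 1"
          and sol: "ode_sol (\<lambda>t x. f (x / \<epsilon>) (t / \<epsilon>) x t) c Ue" "ode_sol (\<lambda>t x. fbar x t) c Ub"
        {
          assume t: "\<epsilon> * \<bar>ln \<epsilon>\<bar> < t"
          have "0 \<le> \<epsilon> * \<bar>ln \<epsilon>\<bar>" using \<epsilon> by (intro mult_nonneg_nonneg) auto
          then have "0 \<le> t" using t by linarith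
          then show "\<bar>Ue t - Ub t\<bar> \<le> \<Phi> (w1inf_norm f) * t / \<bar>ln \<epsilon>\<bar>"
            unfolding \<Phi>_K using t by (rule K.rate(1)[OF sol \<epsilon>])
        next
          assume t: "0 \<le> t" "t \<le> \<epsilon> * \<bar>ln \<epsilon>\<bar>"
          show "\<bar>Ue t - Ub t\<bar> \<le> min (\<Phi> (w1inf_norm f) * \<epsilon>) (2 * sup_norm f * t)"
            unfolding \<Phi>_K using K.rate(2)[OF sol \<epsilon> t] trivial_rate[OF sol t(1)]
            by (rule min.boundedI)
        }
      qed
    qed
  qed
qed

end
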